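(* Let $(R,\mathfrak m)$ be a one-dimensional Noetherian local ring, let $I$ be a proper regular ideal of $R$, and let $a,b\in R$. Then the Cohen-Macaulay type of $R(I)_{a,b}$ is $$t(R(I)_{a,b})=\lambda_R\left(\frac{(I:I)\cap (R:\mathfrak m)}{R}\right)+\lambda_R\left(\frac{I:\mathfrak m}{I}\right).$$ In particular, it does not depend on $a$ and $b$.
   Context: All rings are commutative with unity. For an ideal $I$ of $R$, the Rees algebra is $\mathcal R_+=\bigoplus_{n\ge 0} I^nt^n\subseteq R[t]$. For $a,b\in R$, let $(I^2(t^2+at+b))$ denote the ideal $(t^2+at+b)R[t]\cap \mathcal R_+$ of $\mathcal R_+$, and set $R(I)_{a,b}=\mathcal R_+/(I^2(t^2+at+b))$. Each element of $R(I)_{a,b}$ is uniquely represented by a polynomial $r+it$ with $r\in R$, $i\in I$. A regular ideal is an ideal containing a regular element (non-zero-divisor). Here $R(I)_{a,b}$ is a one-dimensional Cohen-Macaulay local ring with maximal ideal $M=\{r+it : r\in\mathfrak m, i\in I\}$; its Cohen-Macaulay type is the length of the $R(I)_{a,b}$-module $(R(I)_{a,b}:M)/R(I)_{a,b}$, the colon being taken in the total ring of fractions of $R(I)_{a,b}$. The colons $I:I$, $R:\mathfrak m$, $I:\mathfrak m$ are taken in the total ring of fractions $Q(R)$ of $R$, i.e. $J:K=\{x\in Q(R) : xK\subseteq J\}$. $\lambda_R$ denotes length of an $R$-module. *)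

theory Defs
  imports "HOL-Library.Extended_Nat" "HOL-Algebra.Ring_Divisibility" "HOL-Algebra.Ideal_Product"
    "HOL-Algebra.QuotRing" "HOL-Algebra.UnivPoly"
begin

section \<open>Local rings and Krull dimension\<close>

locale local_ring = cring R + maximalideal \<mm> R for \<mm> and R (structure) +
  assumes maximalideal_unique: "maximalideal J R \<Longrightarrow> J = \<mm>"

definition krull_dim :: "('a, 'm) ring_scheme \<Rightarrow> enat"
  where "krull_dim R = Sup {enat n | n. \<exists>P :: nat \<Rightarrow> 'a set.
    (\<forall>i\<le>n. primeideal (P i) R) \<and> (\<forall>i<n. P i \<subset> P (Suc i))}"


section \<open>The total ring of fractions\<close>

definition regular_elems :: "('a, 'm) ring_scheme \<Rightarrow> 'a set"
  where "regular_elems R =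
    {s \<in> carrier R. \<forall>x\<in>carrier R. s \<otimes>\<^bsub>R\<^esub> x = \<zero>\<^bsub>R\<^esub> \<longrightarrow> x = \<zero>\<^bsub>R\<^esub>}"

definition regular_ideal :: "'a set \<Rightarrow> ('a, 'm) ring_scheme \<Rightarrow> bool"
  where "regular_ideal I R \<longleftrightarrow> ideal I R \<and> I \<inter> regular_elems R \<noteq> {}"

text \<open>\<open>fraction R r s\<close> is the fraction \<open>r/s\<close>, as a class of pairs (numerator, denominator).\<close>

definition fraction :: "('a, 'm) ring_scheme \<Rightarrow> 'a \<Rightarrow> 'a \<Rightarrow> ('a \<times> 'a) set"
  where "fraction R r s =
    {(r', s'). r' \<in> carrier R \<and> s' \<in> regular_elems R \<and> r \<otimes>\<^bsub>R\<^esub> s' = r' \<otimes>\<^bsub>R\<^esub> s}"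

definition frac_embed :: "('a, 'm) ring_scheme \<Rightarrow> 'a \<Rightarrow> ('a \<times> 'a) set"
  where "frac_embed R r = fraction R r \<one>\<^bsub>R\<^esub>"

text \<open>
  The record is a module record: besides the ring structure of the total ring of fractions it
  carries the scalar action of \<^term>\<open>R\<close>.
\<close>

definition total_frac :: "('a, 'm) ring_scheme \<Rightarrow> ('a, ('a \<times> 'a) set) module"
  where "total_frac R =
    \<lparr>carrier = {fraction R r s | r s. r \<in> carrier R \<and> s \<in> regular_elems R},
     mult = (\<lambda>x y. \<Union>(r, s)\<in>x. \<Union>(r', s')\<in>y. fraction R (r \<otimes>\<^bsub>R\<^esub> r') (s \<otimes>\<^bsub>R\<^esub> s')),
     one = fraction R \<one>\<^bsub>R\<^esub> \<one>\<^bsub>R\<^esub>,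
     zero = fraction R \<zero>\<^bsub>R\<^esub> \<one>\<^bsub>R\<^esub>,
     add = (\<lambda>x y. \<Union>(r, s)\<in>x. \<Union>(r', s')\<in>y.
       fraction R (r \<otimes>\<^bsub>R\<^esub> s' \<oplus>\<^bsub>R\<^esub> r' \<otimes>\<^bsub>R\<^esub> s) (s \<otimes>\<^bsub>R\<^esub> s')),
     smult = (\<lambda>c x. \<Union>(r, s)\<in>x. fraction R (c \<otimes>\<^bsub>R\<^esub> r) s)\<rparr>"

text \<open>
  In \<open>J : K\<close> both arguments are subsets of the total ring of fractions; an ideal \<open>I\<close>
  of \<open>R\<close> enters as its image \<open>frac_embed R ` I\<close>.
\<close>

definition colon :: "('a, 'm) ring_scheme \<Rightarrow> ('a \<times> 'a) set set \<Rightarrow> ('a \<times> 'a) set set \<Rightarrow> ('a \<times> 'a) set set"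
  where "colon R J K = {x \<in> carrier (total_frac R). \<forall>k\<in>K. x \<otimes>\<^bsub>total_frac R\<^esub> k \<in> J}"


section \<open>Length of modules\<close>

definition module_length :: "('a, 'm) ring_scheme \<Rightarrow> ('a, 'b, 'n) module_scheme \<Rightarrow> enat"
  where "module_length R M = Sup {enat n | n. \<exists>N :: nat \<Rightarrow> 'b set.
    (\<forall>i\<le>n. submodule (N i) R M) \<and> (\<forall>i<n. N i \<subset> N (Suc i))}"

text \<open>
  The quotient \<open>N/P\<close> of submodules \<open>P \<subseteq> N\<close> of \<open>M\<close>. The ring multiplication and unit fields of
  the module record play no role in a module and are left unspecified.
\<close>

definition quot_module ::
    "('a, 'b, 'n) module_scheme \<Rightarrow> 'b set \<Rightarrow> 'b set \<Rightarrow> ('a, 'b set) module"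
  where "quot_module M N P =
    \<lparr>carrier = a_rcosets\<^bsub>M\<lparr>carrier := N\<rparr>\<^esub> P,
     mult = undefined,
     one = undefined,
     zero = P,
     add = set_add M,
     smult = (\<lambda>c C. \<Union>x\<in>C. P +>\<^bsub>M\<^esub> (c \<odot>\<^bsub>M\<^esub> x))\<rparr>"

text \<open>
  The length over \<^term>\<open>R\<close> of \<open>N/P\<close>, for \<open>R\<close>-submodules \<open>P \<subseteq> N\<close> of the total ring of fractions.
\<close>

abbreviation frac_length ::
    "('a, 'm) ring_scheme \<Rightarrow> ('a \<times> 'a) set set \<Rightarrow> ('a \<times> 'a) set set \<Rightarrow> enat"
  where "frac_length R N P \<equiv> module_length R (quot_module (total_frac R) N P)"

text \<open>The Cohen-Macaulay type of a one-dimensional Cohen-Macaulay local ring.\<close>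

definition cm_type :: "('a, 'm) ring_scheme \<Rightarrow> enat"
  where "cm_type S = (let S' = frac_embed S ` carrier S; M = (THE M. maximalideal M S) in
    frac_length S (colon S S' (frac_embed S ` M)) S')"


section \<open>The Rees algebra and its quotients\<close>

text \<open>Ideal powers are taken in the monoid of ideals \<^const>\<open>ideals_set\<close>, so the zeroth one is \<open>R\<close>.\<close>

definition rees_algebra :: "('a, 'm) ring_scheme \<Rightarrow> 'a set \<Rightarrow> ('a, nat \<Rightarrow> 'a) up_ring"
  where "rees_algebra R I = (UP R)\<lparr>carrier :=
    {p \<in> carrier (UP R). \<forall>n. coeff (UP R) p n \<in> I [^]\<^bsub>ideals_set R\<^esub> n}\<rparr>"

definition quad_poly :: "('a, 'm) ring_scheme \<Rightarrow> 'a \<Rightarrow> 'a \<Rightarrow> nat \<Rightarrow> 'a"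
  where "quad_poly R a b =
    monom (UP R) \<one>\<^bsub>R\<^esub> 2 \<oplus>\<^bsub>UP R\<^esub> monom (UP R) a 1 \<oplus>\<^bsub>UP R\<^esub> monom (UP R) b 0"

definition rees_quotient :: "('a, 'm) ring_scheme \<Rightarrow> 'a set \<Rightarrow> 'a \<Rightarrow> 'a \<Rightarrow> (nat \<Rightarrow> 'a) set ring"
  where "rees_quotient R I a b =
    rees_algebra R I Quot ((PIdl\<^bsub>UP R\<^esub> quad_poly R a b) \<inter> carrier (rees_algebra R I))"

end

theory Submission
  imports Defs "HOL-Algebra.Subrings"
begin

text \<open>
  Fix a regular element \<open>x\<close> of \<open>I\<close>. As \<open>x\<close> lies in \<open>I\<close>, in \<open>\<mm>\<close> and in the maximal ideal of
  \<open>S = R(I)\<^sub>a\<^sub>,\<^sub>b\<close>, every element of one of the colons in the formula is a fraction \<open>u/x\<close> whose numerator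
  \<open>u\<close> lies in \<open>R\<close>, respectively in \<open>S\<close> (\<open>colon_eq_fractions\<close>). Multiplication by \<open>x\<close> therefore turns each of
  the three lengths into the supremum of the lengths of chains of ideals between two given ideals of
  \<open>R\<close> or \<open>S\<close> (\<open>frac_length_eq_height_ideals\<close>), and the total rings of fractions disappear.

  Division by the monic polynomial \<open>t\<^sup>2 + at + b\<close> identifies \<open>S\<close> with the subring \<open>R + I t\<close> of
  \<open>R[t]/(t\<^sup>2 + at + b)\<close> (\<open>rees_quotient_iso\<close>), which is modelled by pairs. An element \<open>r + i t\<close> whose
  constant term \<open>r\<close> is a unit is a unit, its norm being \<open>r\<^sup>2\<close> up to an element of \<open>I \<subseteq> \<mm>\<close>; hence \<open>\<mm> + I t\<close>
  is the maximal ideal \<open>M\<close> of \<open>S\<close> (\<open>quad_sub_units\<close>).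

  Multiplying \<open>u + v t\<close> by \<open>m \<in> \<mm>\<close> and by \<open>i t\<close> with \<open>i \<in> I\<close> shows that \<open>(u + v t) M \<subseteq> x S\<close> holds if and only
  if \<open>u \<mm> \<subseteq> x R\<close>, \<open>u I \<subseteq> x I\<close> and \<open>v \<mm> \<subseteq> x I\<close> (\<open>colon_eq\<close>). The numerators of \<open>S : M\<close> thus form
  \<open>A \<times> B\<close>, where \<open>A\<close> and \<open>B\<close> are the numerators of \<open>(I : I) \<inter> (R : \<mm>)\<close> and of \<open>I : \<mm>\<close>, while those of \<open>S\<close> form
  \<open>x R \<times> x I\<close>. An ideal of \<open>S\<close> between the two is compared with its intersection with \<open>A\<close> and its
  projection to \<open>B\<close>, which are ideals of \<open>R\<close>; products of ideals of \<open>R\<close> in the respective ranges are in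
  turn ideals of \<open>S\<close>. So the lengths add up (\<open>height_split\<close>), and the polynomial enters neither
  summand.
\<close>

section \<open>Lengths of chains in a family of sets\<close>

text \<open>
  Chains are counted in arbitrary families of sets, so that chains of submodules of the various
  quotients and chains of ideals become comparable by monotone maps between the families.
\<close>
definition height :: "'a set set \<Rightarrow> enat"
  where "height F = Sup {enat n | n. \<exists>N :: nat \<Rightarrow> 'a set.
    (\<forall>i\<le>n. N i \<in> F) \<and> (\<forall>i<n. N i \<subset> N (Suc i))}"

lemma module_length_eq_height: "module_length R M = height {N. submodule N R M}"
  by (simp add: module_length_def height_def)

lemma height_upper:
  assumes "\<And>i. i \<le> n \<Longrightarrow> N i \<in> F" and "\<And>i. i < n \<Longrightarrow> N i \<subset> N (Suc i)"
  shows "enat n \<le> height F"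
  unfolding height_def using assms by (intro Sup_upper) blast

lemma height_least:
  assumes "\<And>n N. (\<And>i. i \<le> n \<Longrightarrow> N i \<in> F) \<Longrightarrow> (\<And>i. i < n \<Longrightarrow> N i \<subset> N (Suc i)) \<Longrightarrow> enat n \<le> h"
  shows "height F \<le> h"
  unfolding height_def using assms by (intro Sup_least) blast

lemma height_le_of_strict_mono:
  assumes "\<And>X. X \<in> F \<Longrightarrow> f X \<in> G"
    and "\<And>X Y. X \<in> F \<Longrightarrow> Y \<in> F \<Longrightarrow> X \<subset> Y \<Longrightarrow> f X \<subset> f Y"
  shows "height F \<le> height G"
proof (rule height_least)
  fix n N assume N: "\<And>i. i \<le> n \<Longrightarrow> N i \<in> F" "\<And>i. i < n \<Longrightarrow> N i \<subset> N (Suc i)"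
  show "enat n \<le> height G"
    by (rule height_upper[where N = "f \<circ> N"]) (use N assms in auto)
qed

text \<open>
  A weakly increasing sequence may be thinned out to a strict chain, so its number of strict
  steps is bounded by the height. The end of the chain is recorded to make the induction work.
\<close>
lemma strict_chain_of_mono_sequence:
  assumes "\<And>i. i \<le> n \<Longrightarrow> X i \<in> F" and "\<And>i. i < n \<Longrightarrow> X i \<subseteq> X (Suc i)"
  shows "\<exists>N. (\<forall>i \<le> card {i. i < n \<and> X i \<noteq> X (Suc i)}. N i \<in> F)
    \<and> (\<forall>i < card {i. i < n \<and> X i \<noteq> X (Suc i)}. N i \<subset> N (Suc i))
    \<and> N (card {i. i < n \<and> X i \<noteq> X (Suc i)}) = X n"
  using assms
proof (induction n)
  case 0
  then show ?case by (intro exI[of _ X]) auto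
next
  case (Suc n)
  define s where "s = card {i. i < n \<and> X i \<noteq> X (Suc i)}"
  have "\<exists>N. (\<forall>i \<le> s. N i \<in> F) \<and> (\<forall>i < s. N i \<subset> N (Suc i)) \<and> N s = X n"
    unfolding s_def by (rule Suc.IH; rule Suc.prems; simp)
  then obtain N where N: "\<forall>i \<le> s. N i \<in> F" "\<forall>i < s. N i \<subset> N (Suc i)" "N s = X n"
    by blast
  show ?case
  proof (cases "X n = X (Suc n)")
    case True
    then have "{i. i < Suc n \<and> X i \<noteq> X (Suc i)} = {i. i < n \<and> X i \<noteq> X (Suc i)}"
      by (auto simp: less_Suc_eq)
    then show ?thesis using N unfolding s_def True by (intro exI[of _ N]) simp
  next
    case False
    then have "{i. i < Suc n \<and> X i \<noteq> X (Suc i)} = insert n {i. i < n \<and> X i \<noteq> X (Suc i)}"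
      by (auto simp: less_Suc_eq)
    then have s: "card {i. i < Suc n \<and> X i \<noteq> X (Suc i)} = Suc s"
      unfolding s_def by simp
    have ext: "X n \<subset> X (Suc n)" "X (Suc n) \<in> F"
      using False Suc.prems(2)[of n] Suc.prems(1)[of "Suc n"] by (simp_all add: psubset_eq)
    define N' where "N' = (\<lambda>i. if i = Suc s then X (Suc n) else N i)"
    have "\<forall>i \<le> Suc s. N' i \<in> F"
      using N(1) ext(2) unfolding N'_def by simp
    moreover have "N' i \<subset> N' (Suc i)" if "i < Suc s" for i
      using N(2,3) ext(1) that unfolding N'_def by (cases "i = s") simp_all
    moreover have "N' (Suc s) = X (Suc n)" unfolding N'_def by simp
    ultimately show ?thesis unfolding s by (intro exI[of _ N']) simp
  qed
qed

lemma count_strict_steps_le_height: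
  assumes "\<And>i. i \<le> n \<Longrightarrow> X i \<in> F" and "\<And>i. i < n \<Longrightarrow> X i \<subseteq> X (Suc i)"
  shows "enat (card {i. i < n \<and> X i \<noteq> X (Suc i)}) \<le> height F"
proof -
  let ?s = "card {i. i < n \<and> X i \<noteq> X (Suc i)}"
  obtain N where "\<forall>i \<le> ?s. N i \<in> F" "\<forall>i < ?s. N i \<subset> N (Suc i)"
    using strict_chain_of_mono_sequence[of n X F] assms by blast
  then show ?thesis by (intro height_upper[where N = N]) auto
qed

lemma Sup_add_le_enat:
  fixes A B :: "enat set"
  assumes "A \<noteq> {}" "B \<noteq> {}" and le: "\<And>p q. p \<in> A \<Longrightarrow> q \<in> B \<Longrightarrow> p + q \<le> h"
  shows "Sup A + Sup B \<le> h"
proof (cases h)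
  case (enat k)
  have fin: "p + Sup B \<le> enat k" if p: "p \<in> A" for p
  proof -
    obtain q where "q \<in> B" using assms by blast
    then obtain p' where p': "p = enat p'" "p' \<le> k"
      using le[OF p, of q] enat by (cases p; cases q) auto
    have "Sup B \<le> enat (k - p')"
    proof (rule Sup_least)
      fix q assume "q \<in> B"
      then show "q \<le> enat (k - p')" using le[OF p, of q] p' enat by (cases q) auto
    qed
    then show ?thesis using p' by (cases "Sup B") auto
  qed
  obtain l where l: "Sup B = enat l" "l \<le> k"
  proof -
    obtain p where "p \<in> A" using assms by blast
    from fin[OF this] that show thesis by (cases "Sup B"; cases p) auto
  qed
  have "Sup A \<le> enat (k - l)"
  proof (rule Sup_least)
    fix p assume "p \<in> A"
    then show "p \<le> enat (k - l)" using fin[of p] l by (cases p) auto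
  qed
  then show ?thesis using l enat by (cases "Sup A") auto
qed simp

text \<open>
  This is additivity of length along a short exact sequence in lattice form: \<open>\<pi>\<close> and \<open>\<rho>\<close> are the
  traces of a submodule on the sub and on the quotient, which together detect strict inclusions,
  and \<open>\<sigma>\<close> builds a submodule from its two traces.
\<close>
lemma height_eq_add:
  assumes ne: "G \<noteq> {}" "H \<noteq> {}"
    and \<pi>: "\<And>X. X \<in> F \<Longrightarrow> \<pi> X \<in> G" "\<And>X Y. X \<in> F \<Longrightarrow> Y \<in> F \<Longrightarrow> X \<subseteq> Y \<Longrightarrow> \<pi> X \<subseteq> \<pi> Y"
    and \<rho>: "\<And>X. X \<in> F \<Longrightarrow> \<rho> X \<in> H" "\<And>X Y. X \<in> F \<Longrightarrow> Y \<in> F \<Longrightarrow> X \<subseteq> Y \<Longrightarrow> \<rho> X \<subseteq> \<rho> Y"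
    and joint: "\<And>X Y. X \<in> F \<Longrightarrow> Y \<in> F \<Longrightarrow> X \<subseteq> Y \<Longrightarrow> \<pi> X = \<pi> Y \<Longrightarrow> \<rho> X = \<rho> Y \<Longrightarrow> X = Y"
    and \<sigma>: "\<And>U V. U \<in> G \<Longrightarrow> V \<in> H \<Longrightarrow> \<sigma> U V \<in> F"
      "\<And>U U' V. U \<in> G \<Longrightarrow> U' \<in> G \<Longrightarrow> V \<in> H \<Longrightarrow> U \<subset> U' \<Longrightarrow> \<sigma> U V \<subset> \<sigma> U' V"
      "\<And>U V V'. U \<in> G \<Longrightarrow> V \<in> H \<Longrightarrow> V' \<in> H \<Longrightarrow> V \<subset> V' \<Longrightarrow> \<sigma> U V \<subset> \<sigma> U V'"
  shows "height F = height G + height H"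
proof (rule antisym)
  show "height F \<le> height G + height H"
  proof (rule height_least)
    fix n N assume N: "\<And>i. i \<le> n \<Longrightarrow> N i \<in> F" "\<And>i. i < n \<Longrightarrow> N i \<subset> N (Suc i)"
    let ?S = "{i. i < n \<and> \<pi> (N i) \<noteq> \<pi> (N (Suc i))}"
    let ?T = "{i. i < n \<and> \<rho> (N i) \<noteq> \<rho> (N (Suc i))}"
    have S: "enat (card ?S) \<le> height G"
    proof (rule count_strict_steps_le_height)
      show "\<pi> (N i) \<in> G" if "i \<le> n" for i using \<pi>(1) N(1) that by blast
      show "\<pi> (N i) \<subseteq> \<pi> (N (Suc i))" if "i < n" for i
        by (rule \<pi>(2)) (use N(1)[of i] N(1)[of "Suc i"] N(2)[of i] that in auto)
    qed
    have T: "enat (card ?T) \<le> height H"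
    proof (rule count_strict_steps_le_height)
      show "\<rho> (N i) \<in> H" if "i \<le> n" for i using \<rho>(1) N(1) that by blast
      show "\<rho> (N i) \<subseteq> \<rho> (N (Suc i))" if "i < n" for i
        by (rule \<rho>(2)) (use N(1)[of i] N(1)[of "Suc i"] N(2)[of i] that in auto)
    qed
    have "{..<n} \<subseteq> ?S \<union> ?T"
    proof
      fix i assume "i \<in> {..<n}"
      then have i: "i < n" by simp
      then have "N i \<subseteq> N (Suc i)" "N i \<noteq> N (Suc i)" using N(2)[of i] by blast+
      then have "\<pi> (N i) \<noteq> \<pi> (N (Suc i)) \<or> \<rho> (N i) \<noteq> \<rho> (N (Suc i))"
        using joint[of "N i" "N (Suc i)"] N(1)[of i] N(1)[of "Suc i"] i by fastforce
      then show "i \<in> ?S \<union> ?T" using i by blast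
    qed
    then have "n \<le> card (?S \<union> ?T)" using card_mono[of "?S \<union> ?T" "{..<n}"] by simp
    also have "\<dots> \<le> card ?S + card ?T" by (rule card_Un_le)
    finally have "enat n \<le> enat (card ?S) + enat (card ?T)" by simp
    also have "\<dots> \<le> height G + height H" using S T by (rule add_mono)
    finally show "enat n \<le> height G + height H" .
  qed
next
  show "height G + height H \<le> height F"
    unfolding height_def[of G] height_def[of H]
  proof (rule Sup_add_le_enat)
    obtain U V where UV: "U \<in> G" "V \<in> H" using ne by blast
    show "{enat n | n. \<exists>N. (\<forall>i\<le>n. N i \<in> G) \<and> (\<forall>i<n. N i \<subset> N (Suc i))} \<noteq> {}"
      using UV(1) by (auto intro!: exI[of _ 0] exI[of _ "\<lambda>_. U"])
    show "{enat n | n. \<exists>N. (\<forall>i\<le>n. N i \<in> H) \<and> (\<forall>i<n. N i \<subset> N (Suc i))} \<noteq> {}"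
      using UV(2) by (auto intro!: exI[of _ 0] exI[of _ "\<lambda>_. V"])
  next
    fix p q
    assume "p \<in> {enat n | n. \<exists>N. (\<forall>i\<le>n. N i \<in> G) \<and> (\<forall>i<n. N i \<subset> N (Suc i))}"
      and "q \<in> {enat n | n. \<exists>N. (\<forall>i\<le>n. N i \<in> H) \<and> (\<forall>i<n. N i \<subset> N (Suc i))}"
    then obtain m n M N where p: "p = enat m" and q: "q = enat n"
      and M: "\<forall>i\<le>m. M i \<in> G" "\<forall>i<m. M i \<subset> M (Suc i)"
      and N: "\<forall>i\<le>n. N i \<in> H" "\<forall>i<n. N i \<subset> N (Suc i)" by blast
    \<comment> \<open>first climb along the chain in \<open>G\<close> over the bottom of \<open>N\<close>, then along the chain in \<open>H\<close>\<close>
    let ?C = "\<lambda>i. if i \<le> m then \<sigma> (M i) (N 0) else \<sigma> (M m) (N (i - m))"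
    have "enat (m + n) \<le> height F"
    proof (rule height_upper[where N = ?C])
      fix i assume "i \<le> m + n"
      then show "?C i \<in> F" using M(1) N(1) \<sigma>(1) by auto
    next
      fix i assume i: "i < m + n"
      consider "i < m" | "i = m" | "i > m" by linarith
      then show "?C i \<subset> ?C (Suc i)"
      proof cases
        case 1
        then have "\<sigma> (M i) (N 0) \<subset> \<sigma> (M (Suc i)) (N 0)" using M N by (intro \<sigma>(2)) simp_all
        then show ?thesis using 1 by simp
      next
        case 2
        then have "\<sigma> (M m) (N 0) \<subset> \<sigma> (M m) (N (Suc 0))" using M N i by (intro \<sigma>(3)) simp_all
        then show ?thesis using 2 by simp
      next
        case 3
        then have "\<sigma> (M m) (N (i - m)) \<subset> \<sigma> (M m) (N (Suc (i - m)))" using M N i by (intro \<sigma>(3)) simp_all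
        then show ?thesis using 3 by (simp add: Suc_diff_le)
      qed
    qed
    then show "p + q \<le> height F" using p q by simp
  qed
qed

section \<open>Arithmetic in the total ring of fractions\<close>

lemma total_frac_mult:
  "x \<otimes>\<^bsub>total_frac R\<^esub> y
    = (\<Union>(r, s)\<in>x. \<Union>(r', s')\<in>y. fraction R (r \<otimes>\<^bsub>R\<^esub> r') (s \<otimes>\<^bsub>R\<^esub> s'))"
  by (simp add: total_frac_def)

lemma total_frac_add:
  "x \<oplus>\<^bsub>total_frac R\<^esub> y = (\<Union>(r, s)\<in>x. \<Union>(r', s')\<in>y.
    fraction R (r \<otimes>\<^bsub>R\<^esub> s' \<oplus>\<^bsub>R\<^esub> r' \<otimes>\<^bsub>R\<^esub> s) (s \<otimes>\<^bsub>R\<^esub> s'))"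
  by (simp add: total_frac_def)

lemma total_frac_smult:
  "c \<odot>\<^bsub>total_frac R\<^esub> x = (\<Union>(r, s)\<in>x. fraction R (c \<otimes>\<^bsub>R\<^esub> r) s)"
  by (simp add: total_frac_def)

context cring
begin

lemma regular_elems_carrier [dest]: "s \<in> regular_elems R \<Longrightarrow> s \<in> carrier R"
  by (simp add: regular_elems_def)

lemma regular_elemsD: "s \<in> regular_elems R \<Longrightarrow> x \<in> carrier R \<Longrightarrow> s \<otimes> x = \<zero> \<Longrightarrow> x = \<zero>"
  by (simp add: regular_elems_def)

lemma regular_l_cancel:
  assumes s: "s \<in> regular_elems R" and xy: "x \<in> carrier R" "y \<in> carrier R"
  shows "s \<otimes> x = s \<otimes> y \<longleftrightarrow> x = y"
proof
  assume "s \<otimes> x = s \<otimes> y"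
  then have "s \<otimes> (x \<ominus> y) = \<zero>"
    using s xy by (simp add: regular_elems_carrier minus_eq r_distr r_minus r_neg)
  then have "x \<ominus> y = \<zero>" using regular_elemsD[OF s] xy by simp
  then show "x = y" using xy by simp
qed simp

lemma regular_r_cancel:
  assumes "s \<in> regular_elems R" "x \<in> carrier R" "y \<in> carrier R"
  shows "x \<otimes> s = y \<otimes> s \<longleftrightarrow> x = y"
  using regular_l_cancel[OF assms] assms by (simp add: m_comm regular_elems_carrier)

lemma regular_one [simp]: "\<one> \<in> regular_elems R"
  by (simp add: regular_elems_def)

lemma regular_mult [simp]:
  assumes "s \<in> regular_elems R" "t \<in> regular_elems R"
  shows "s \<otimes> t \<in> regular_elems R"
proof -
  have c: "s \<in> carrier R" "t \<in> carrier R" using assms by auto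
  have "x = \<zero>" if x: "x \<in> carrier R" and "s \<otimes> t \<otimes> x = \<zero>" for x
  proof -
    have "t \<otimes> x = \<zero>"
      using regular_elemsD[OF assms(1), of "t \<otimes> x"] that c by (simp add: m_assoc)
    then show ?thesis by (rule regular_elemsD[OF assms(2) x])
  qed
  then show ?thesis using c by (simp add: regular_elems_def)
qed

lemma fraction_eq_iff:
  assumes "r \<in> carrier R" "r' \<in> carrier R" "s \<in> regular_elems R" "s' \<in> regular_elems R"
  shows "fraction R r s = fraction R r' s' \<longleftrightarrow> r \<otimes> s' = r' \<otimes> s"
proof
  note c = assms assms(3,4)[THEN regular_elems_carrier]
  assume "fraction R r s = fraction R r' s'"
  moreover have "(r', s') \<in> fraction R r' s'" using c by (simp add: fraction_def)
  ultimately show "r \<otimes> s' = r' \<otimes> s" by (auto simp: fraction_def)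
next
  note c = assms assms(3,4)[THEN regular_elems_carrier]
  assume eq: "r \<otimes> s' = r' \<otimes> s"
  have "r \<otimes> v = u \<otimes> s \<longleftrightarrow> r' \<otimes> v = u \<otimes> s'" if uv: "u \<in> carrier R" "v \<in> regular_elems R" for u v
  proof -
    have v: "v \<in> carrier R" using uv by auto
    have "r \<otimes> v = u \<otimes> s \<longleftrightarrow> r \<otimes> v \<otimes> s' = u \<otimes> s \<otimes> s'"
      using c uv v by (simp add: regular_r_cancel)
    also have "r \<otimes> v \<otimes> s' = r' \<otimes> v \<otimes> s" using eq c v by (metis m_assoc m_comm)
    also have "u \<otimes> s \<otimes> s' = u \<otimes> s' \<otimes> s" using c uv by (simp add: m_ac)
    also have "r' \<otimes> v \<otimes> s = u \<otimes> s' \<otimes> s \<longleftrightarrow> r' \<otimes> v = u \<otimes> s'"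
      using c uv v by (simp add: regular_r_cancel)
    finally show ?thesis .
  qed
  then show "fraction R r s = fraction R r' s'" unfolding fraction_def by auto
qed

lemma fraction_self: "r \<in> carrier R \<Longrightarrow> s \<in> regular_elems R \<Longrightarrow> (r, s) \<in> fraction R r s"
  by (simp add: fraction_def)

lemma fraction_memD:
  assumes "(u, v) \<in> fraction R r s"
  shows "u \<in> carrier R" "v \<in> regular_elems R" "v \<in> carrier R" "r \<otimes> v = u \<otimes> s"
  using assms by (auto simp: fraction_def)

lemma UN_pairs_const:
  assumes "z \<in> A" "z' \<in> B" and "\<And>r s r' s'. (r, s) \<in> A \<Longrightarrow> (r', s') \<in> B \<Longrightarrow> f r s r' s' = c"
  shows "(\<Union>(r, s)\<in>A. \<Union>(r', s')\<in>B. f r s r' s') = c"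
proof -
  have "(case p of (r, s) \<Rightarrow> \<Union>(r', s')\<in>B. f r s r' s') = c" if p: "p \<in> A" for p
  proof (cases p)
    case (Pair r s)
    have "(case q of (r', s') \<Rightarrow> f r s r' s') = c" if "q \<in> B" for q
      using assms(3)[of r s "fst q" "snd q"] that p Pair by (simp add: case_prod_beta)
    from UN_constant_eq[OF assms(2) ballI, OF this] show ?thesis by (simp add: Pair)
  qed
  from UN_constant_eq[OF assms(1) ballI, OF this] show ?thesis by simp
qed

lemma fraction_mult:
  assumes "r \<in> carrier R" "r' \<in> carrier R" "s \<in> regular_elems R" "s' \<in> regular_elems R"
  shows "fraction R r s \<otimes>\<^bsub>total_frac R\<^esub> fraction R r' s' = fraction R (r \<otimes> r') (s \<otimes> s')"
proof -
  note c = assms assms(3,4)[THEN regular_elems_carrier]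
  have "fraction R (u \<otimes> u') (v \<otimes> v') = fraction R (r \<otimes> r') (s \<otimes> s')"
    if uv: "(u, v) \<in> fraction R r s" and uv': "(u', v') \<in> fraction R r' s'" for u v u' v'
  proof -
    note d = fraction_memD[OF uv] fraction_memD[OF uv']
    have "(u \<otimes> u') \<otimes> (s \<otimes> s') = (u \<otimes> s) \<otimes> (u' \<otimes> s')"
      using c d(1-3,5-7) by (simp add: m_ac)
    also have "\<dots> = (r \<otimes> r') \<otimes> (v \<otimes> v')"
      unfolding d(4,8)[symmetric] using c d(1-3,5-7) by (simp add: m_ac)
    finally show ?thesis using c d(1-3,5-7) by (simp add: fraction_eq_iff)
  qed
  from UN_pairs_const[where f = "\<lambda>u v u' v'. fraction R (u \<otimes> u') (v \<otimes> v')",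
      OF fraction_self[OF assms(1,3)] fraction_self[OF assms(2,4)] this]
  show ?thesis unfolding total_frac_mult .
qed

lemma fraction_add:
  assumes "r \<in> carrier R" "r' \<in> carrier R" "s \<in> regular_elems R" "s' \<in> regular_elems R"
  shows "fraction R r s \<oplus>\<^bsub>total_frac R\<^esub> fraction R r' s'
    = fraction R (r \<otimes> s' \<oplus> r' \<otimes> s) (s \<otimes> s')"
proof -
  note c = assms assms(3,4)[THEN regular_elems_carrier]
  have "fraction R (u \<otimes> v' \<oplus> u' \<otimes> v) (v \<otimes> v') = fraction R (r \<otimes> s' \<oplus> r' \<otimes> s) (s \<otimes> s')"
    if uv: "(u, v) \<in> fraction R r s" and uv': "(u', v') \<in> fraction R r' s'" for u v u' v'
  proof -
    note d = fraction_memD[OF uv] fraction_memD[OF uv']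
    have "u \<otimes> v' \<otimes> (s \<otimes> s') = (u \<otimes> s) \<otimes> (v' \<otimes> s')"
      using c d(1-3,5-7) by (simp add: m_ac)
    then have 1: "u \<otimes> v' \<otimes> (s \<otimes> s') = r \<otimes> s' \<otimes> (v \<otimes> v')"
      unfolding d(4)[symmetric] using c d(1-3,5-7) by (simp add: m_ac)
    have "u' \<otimes> v \<otimes> (s \<otimes> s') = (u' \<otimes> s') \<otimes> (v \<otimes> s)"
      using c d(1-3,5-7) by (simp add: m_ac)
    then have 2: "u' \<otimes> v \<otimes> (s \<otimes> s') = r' \<otimes> s \<otimes> (v \<otimes> v')"
      unfolding d(8)[symmetric] using c d(1-3,5-7) by (simp add: m_ac)
    have "(u \<otimes> v' \<oplus> u' \<otimes> v) \<otimes> (s \<otimes> s') = u \<otimes> v' \<otimes> (s \<otimes> s') \<oplus> u' \<otimes> v \<otimes> (s \<otimes> s')"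
      by (rule l_distr) (use c d(1-3,5-7) in simp_all)
    also have "\<dots> = (r \<otimes> s' \<oplus> r' \<otimes> s) \<otimes> (v \<otimes> v')"
      unfolding 1 2 by (rule l_distr[symmetric]) (use c d(1-3,5-7) in simp_all)
    finally show ?thesis
      by (subst fraction_eq_iff) (use c d(1-3,5-7) in simp_all)
  qed
  from UN_pairs_const[where f = "\<lambda>u v u' v'. fraction R (u \<otimes> v' \<oplus> u' \<otimes> v) (v \<otimes> v')",
      OF fraction_self[OF assms(1,3)] fraction_self[OF assms(2,4)] this]
  show ?thesis unfolding total_frac_add .
qed

lemma fraction_smult:
  assumes "r \<in> carrier R" "c \<in> carrier R" "s \<in> regular_elems R"
  shows "c \<odot>\<^bsub>total_frac R\<^esub> fraction R r s = fraction R (c \<otimes> r) s"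
proof -
  note d = assms assms(3)[THEN regular_elems_carrier]
  have "fraction R (c \<otimes> u) v = fraction R (c \<otimes> r) s" if uv: "(u, v) \<in> fraction R r s" for u v
    using fraction_memD[OF uv] d by (simp add: fraction_eq_iff m_assoc)
  then have "\<forall>p\<in>fraction R r s. (case p of (u, v) \<Rightarrow> fraction R (c \<otimes> u) v) = fraction R (c \<otimes> r) s"
    by (simp add: Ball_def split_paired_all)
  from UN_constant_eq[OF fraction_self[OF d(1,3)] this] show ?thesis
    unfolding total_frac_smult .
qed

lemma fraction_inject:
  assumes "u \<in> carrier R" "v \<in> carrier R" "x \<in> regular_elems R"
  shows "fraction R u x = fraction R v x \<longleftrightarrow> u = v"
  using assms by (simp add: fraction_eq_iff regular_r_cancel)

lemma fraction_add_same_denominator: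
  assumes "u \<in> carrier R" "v \<in> carrier R" "x \<in> regular_elems R"
  shows "fraction R u x \<oplus>\<^bsub>total_frac R\<^esub> fraction R v x = fraction R (u \<oplus> v) x"
proof -
  have x: "x \<in> carrier R" using assms by auto
  have "fraction R u x \<oplus>\<^bsub>total_frac R\<^esub> fraction R v x = fraction R (u \<otimes> x \<oplus> v \<otimes> x) (x \<otimes> x)"
    by (rule fraction_add) (use assms in auto)
  also have "u \<otimes> x \<oplus> v \<otimes> x = (u \<oplus> v) \<otimes> x" using assms x by (simp add: l_distr)
  also have "fraction R ((u \<oplus> v) \<otimes> x) (x \<otimes> x) = fraction R (u \<oplus> v) x"
    using assms x by (simp add: fraction_eq_iff m_assoc)
  finally show ?thesis .
qed

lemma frac_embed_eq:
  assumes "u \<in> carrier R" "x \<in> regular_elems R"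
  shows "frac_embed R u = fraction R (x \<otimes> u) x"
  unfolding frac_embed_def using assms by (simp add: fraction_eq_iff m_ac regular_elems_carrier)

section \<open>Clearing a common denominator in colons\<close>

text \<open>
  An element of \<open>J : K\<close> multiplies the regular element \<open>x\<close> of \<open>K\<close> into \<open>J\<close>, hence has the form
  \<open>u/x\<close>. This moves the whole colon into \<open>R\<close>, so that total rings of fractions of different
  rings never have to be compared.
\<close>
lemma colon_eq_fractions:
  assumes J: "J \<subseteq> carrier R" and K: "K \<subseteq> carrier R" and x: "x \<in> K" "x \<in> regular_elems R"
  shows "colon R (frac_embed R ` J) (frac_embed R ` K)
    = (\<lambda>u. fraction R u x) ` {u \<in> carrier R. \<forall>k\<in>K. u \<otimes> k \<in> (\<otimes>) x ` J}"
proof -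
  have xc: "x \<in> carrier R" using x by auto
  have *: "fraction R u x \<otimes>\<^bsub>total_frac R\<^esub> frac_embed R k \<in> frac_embed R ` J \<longleftrightarrow> u \<otimes> k \<in> (\<otimes>) x ` J"
    if "u \<in> carrier R" "k \<in> K" for u k
  proof -
    have k: "k \<in> carrier R" using that K by blast
    have "fraction R u x \<otimes>\<^bsub>total_frac R\<^esub> frac_embed R k = fraction R (u \<otimes> k) x"
      unfolding frac_embed_def using that k x xc by (simp add: fraction_mult)
    moreover have "fraction R (u \<otimes> k) x = frac_embed R j \<longleftrightarrow> u \<otimes> k = x \<otimes> j" if "j \<in> J" for j
    proof -
      have "j \<in> carrier R" using that J by blast
      then show ?thesis
        unfolding frac_embed_def using k x xc \<open>u \<in> carrier R\<close> by (simp add: fraction_eq_iff m_comm)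
    qed
    ultimately show ?thesis unfolding image_iff by metis
  qed
  have **: "\<exists>u\<in>carrier R. fraction R p q = fraction R u x"
    if pq: "p \<in> carrier R" "q \<in> regular_elems R"
      and px: "fraction R p q \<otimes>\<^bsub>total_frac R\<^esub> frac_embed R x \<in> frac_embed R ` J" for p q
  proof -
    have q: "q \<in> carrier R" using pq by auto
    have "fraction R p q \<otimes>\<^bsub>total_frac R\<^esub> frac_embed R x = fraction R (p \<otimes> x) q"
      unfolding frac_embed_def using pq q xc by (simp add: fraction_mult)
    then obtain j where j: "j \<in> J" "fraction R (p \<otimes> x) q = fraction R j \<one>"
      using px by (auto simp: frac_embed_def)
    then have jc: "j \<in> carrier R" using J by blast
    then have "p \<otimes> x = j \<otimes> q" using j pq q xc by (simp add: fraction_eq_iff)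
    then show ?thesis using jc pq x by (intro bexI[of _ j]) (simp add: fraction_eq_iff)
  qed
  show ?thesis
  proof (intro equalityI subsetI)
    fix \<xi> assume \<xi>: "\<xi> \<in> colon R (frac_embed R ` J) (frac_embed R ` K)"
    then obtain p q where pq: "p \<in> carrier R" "q \<in> regular_elems R" "\<xi> = fraction R p q"
      by (auto simp: colon_def total_frac_def)
    have mem: "\<xi> \<otimes>\<^bsub>total_frac R\<^esub> frac_embed R k \<in> frac_embed R ` J" if "k \<in> K" for k
      using \<xi> that by (simp add: colon_def)
    obtain u where u: "u \<in> carrier R" "\<xi> = fraction R u x"
      using **[OF pq(1,2)] mem[OF x(1)] pq(3) by blast
    have "\<forall>k\<in>K. u \<otimes> k \<in> (\<otimes>) x ` J"
      using mem *[OF u(1)] u(2) by blast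
    then show "\<xi> \<in> (\<lambda>u. fraction R u x) ` {u \<in> carrier R. \<forall>k\<in>K. u \<otimes> k \<in> (\<otimes>) x ` J}"
      using u by blast
  next
    fix \<xi> assume "\<xi> \<in> (\<lambda>u. fraction R u x) ` {u \<in> carrier R. \<forall>k\<in>K. u \<otimes> k \<in> (\<otimes>) x ` J}"
    then obtain u where u: "u \<in> carrier R" "\<forall>k\<in>K. u \<otimes> k \<in> (\<otimes>) x ` J" "\<xi> = fraction R u x"
      by blast
    then have "\<xi> \<in> carrier (total_frac R)"
      using x by (auto simp: total_frac_def)
    then show "\<xi> \<in> colon R (frac_embed R ` J) (frac_embed R ` K)"
      unfolding colon_def using u *[OF u(1)] by blast
  qed
qed

lemma frac_embed_image_eq_fractions:
  assumes "J \<subseteq> carrier R" "x \<in> regular_elems R"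
  shows "frac_embed R ` J = (\<lambda>u. fraction R u x) ` (\<otimes>) x ` J"
proof -
  have "frac_embed R u = fraction R (x \<otimes> u) x" if "u \<in> J" for u
    by (rule frac_embed_eq) (use that assms in auto)
  then show ?thesis unfolding image_image by (rule image_cong[OF refl])
qed

end

section \<open>Subquotients of the total ring of fractions\<close>

context cring
begin

lemma ideal_of_closed:
  assumes "K \<subseteq> carrier R" "\<zero> \<in> K"
    and add: "\<And>u v. u \<in> K \<Longrightarrow> v \<in> K \<Longrightarrow> u \<oplus> v \<in> K"
    and mult: "\<And>r u. r \<in> carrier R \<Longrightarrow> u \<in> K \<Longrightarrow> r \<otimes> u \<in> K"
  shows "ideal K R"
proof (rule idealI)
  have neg: "\<ominus> u \<in> K" if "u \<in> K" for u
    using mult[of "\<ominus> \<one>" u] that assms(1) by (auto simp: l_minus)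
  show "subgroup K (add_monoid R)"
    using assms neg by unfold_locales (auto simp flip: a_inv_def)
  show "ring R" by (rule ring_axioms)
  show "r \<otimes> u \<in> K" if "u \<in> K" "r \<in> carrier R" for u r using mult that by blast
  show "u \<otimes> r \<in> K" if "u \<in> K" "r \<in> carrier R" for u r
    using mult[of r u] that assms(1) by (simp add: m_comm subset_iff)
qed

lemma ideal_add_closed: "ideal K R \<Longrightarrow> u \<in> K \<Longrightarrow> v \<in> K \<Longrightarrow> u \<oplus> v \<in> K"
  by (simp add: additive_subgroup.a_closed ideal.axioms(1))

lemma ideal_neg_closed: "ideal K R \<Longrightarrow> u \<in> K \<Longrightarrow> \<ominus> u \<in> K"
  by (simp add: additive_subgroup.a_inv_closed ideal.axioms(1))

lemma ideal_zero_mem: "ideal K R \<Longrightarrow> \<zero> \<in> K"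
  by (simp add: additive_subgroup.zero_closed ideal.axioms(1))

text \<open>
  The correspondence between the submodules of a quotient \<open>N/P\<close> of ideals and the ideals between
  \<open>P\<close> and \<open>N\<close>. The quotient enters only as the target of a linear surjection \<open>\<pi>\<close> with kernel
  \<open>P\<close>: its group structure is transported from \<open>N\<close>.
\<close>
lemma module_length_eq_height_ideals:
  assumes N: "ideal N R" and "P \<subseteq> N"
    and surj: "carrier M = \<pi> ` N"
    and add: "\<And>u v. u \<in> N \<Longrightarrow> v \<in> N \<Longrightarrow> \<pi> u \<oplus>\<^bsub>M\<^esub> \<pi> v = \<pi> (u \<oplus> v)"
    and smult: "\<And>c u. c \<in> carrier R \<Longrightarrow> u \<in> N \<Longrightarrow> c \<odot>\<^bsub>M\<^esub> \<pi> u = \<pi> (c \<otimes> u)"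
    and zero: "\<zero>\<^bsub>M\<^esub> = \<pi> \<zero>"
    and ker: "\<And>u. u \<in> N \<Longrightarrow> \<pi> u = \<pi> \<zero> \<longleftrightarrow> u \<in> P"
  shows "module_length R M = height {K. ideal K R \<and> P \<subseteq> K \<and> K \<subseteq> N}"
proof -
  note Nc = ideal_add_closed[OF N] ideal_neg_closed[OF N] ideal_zero_mem[OF N] ideal.I_l_closed[OF N]
  have NR: "u \<in> carrier R" if "u \<in> N" for u using ideal.Icarr[OF N that] .
  interpret M: abelian_group M
  proof (rule abelian_groupI)
    fix x y z assume "x \<in> carrier M" "y \<in> carrier M" "z \<in> carrier M"
    then obtain u v w where uvw: "u \<in> N" "v \<in> N" "w \<in> N" "x = \<pi> u" "y = \<pi> v" "z = \<pi> w"
      unfolding surj by blast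
    show "x \<oplus>\<^bsub>M\<^esub> y \<oplus>\<^bsub>M\<^esub> z = x \<oplus>\<^bsub>M\<^esub> (y \<oplus>\<^bsub>M\<^esub> z)"
      using uvw Nc NR by (simp add: add a_assoc)
  next
    fix x y assume "x \<in> carrier M" "y \<in> carrier M"
    then obtain u v where uv: "u \<in> N" "v \<in> N" "x = \<pi> u" "y = \<pi> v"
      unfolding surj by blast
    show "x \<oplus>\<^bsub>M\<^esub> y \<in> carrier M" using uv Nc by (simp add: add surj)
    show "x \<oplus>\<^bsub>M\<^esub> y = y \<oplus>\<^bsub>M\<^esub> x" using uv Nc NR by (simp add: add a_comm)
  next
    show "\<zero>\<^bsub>M\<^esub> \<in> carrier M" using Nc by (simp add: zero surj)
  next
    fix x assume "x \<in> carrier M"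
    then obtain u where u: "u \<in> N" "x = \<pi> u" unfolding surj by blast
    show "\<zero>\<^bsub>M\<^esub> \<oplus>\<^bsub>M\<^esub> x = x" using u Nc NR by (simp add: add zero)
    have "\<pi> (\<ominus> u) \<oplus>\<^bsub>M\<^esub> x = \<zero>\<^bsub>M\<^esub>" using u Nc NR by (simp add: add zero l_neg)
    then show "\<exists>y\<in>carrier M. y \<oplus>\<^bsub>M\<^esub> x = \<zero>\<^bsub>M\<^esub>" using u Nc unfolding surj by blast
  qed
  have neg: "\<ominus>\<^bsub>M\<^esub> \<pi> u = \<pi> (\<ominus> u)" if "u \<in> N" for u
    by (rule M.minus_equality) (use that Nc NR in \<open>simp_all add: add zero surj l_neg\<close>)
  have pull: "ideal {u \<in> N. \<pi> u \<in> L} R \<and> P \<subseteq> {u \<in> N. \<pi> u \<in> L} \<and> {u \<in> N. \<pi> u \<in> L} \<subseteq> N"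
    if "submodule L R M" for L
  proof -
    interpret L: submodule L R M by fact
    have z: "\<pi> \<zero> \<in> L" using L.one_closed by (simp add: zero)
    moreover have "\<pi> (u \<oplus> v) \<in> L" if "\<pi> u \<in> L" "\<pi> v \<in> L" "u \<in> N" "v \<in> N" for u v
      using L.m_closed[of "\<pi> u" "\<pi> v"] that by (simp add: add)
    moreover have "\<pi> (r \<otimes> u) \<in> L" if "\<pi> u \<in> L" "r \<in> carrier R" "u \<in> N" for u r
      using L.smult_closed[of r "\<pi> u"] that by (simp add: smult)
    ultimately have "ideal {u \<in> N. \<pi> u \<in> L} R"
      using Nc NR by (intro ideal_of_closed) auto
    moreover have "\<pi> u \<in> L" if "u \<in> P" for u
      using ker[of u] \<open>P \<subseteq> N\<close> that z by (metis subsetD)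
    ultimately show ?thesis using \<open>P \<subseteq> N\<close> by blast
  qed
  have push: "submodule (\<pi> ` K) R M" if K: "ideal K R" "K \<subseteq> N" for K
  proof -
    note Kc = ideal_add_closed[OF K(1)] ideal_neg_closed[OF K(1)] ideal_zero_mem[OF K(1)]
      ideal.I_l_closed[OF K(1)]
    have KN: "u \<in> N" if "u \<in> K" for u using that K(2) by blast
    show ?thesis
    proof (intro submodule.intro subgroup.intro submodule_axioms.intro)
      show "\<pi> ` K \<subseteq> carrier (add_monoid M)" using K(2) surj by auto
      show "\<one>\<^bsub>add_monoid M\<^esub> \<in> \<pi> ` K" using Kc by (simp add: zero)
      show "x \<otimes>\<^bsub>add_monoid M\<^esub> y \<in> \<pi> ` K" if "x \<in> \<pi> ` K" "y \<in> \<pi> ` K" for x y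
        using that Kc KN by (auto simp: add)
      show "inv\<^bsub>add_monoid M\<^esub> x \<in> \<pi> ` K" if "x \<in> \<pi> ` K" for x
        using that Kc KN neg by (auto simp flip: a_inv_def)
      show "c \<odot>\<^bsub>M\<^esub> x \<in> \<pi> ` K" if "c \<in> carrier R" "x \<in> \<pi> ` K" for c x
        using that Kc KN by (auto simp: smult)
    qed
  qed
  have saturated: "u \<in> K" if K: "ideal K R" "P \<subseteq> K" "K \<subseteq> N" and u: "u \<in> N" "\<pi> u \<in> \<pi> ` K" for u K
  proof -
    obtain v where v: "v \<in> K" "\<pi> u = \<pi> v" using u by blast
    then have vN: "v \<in> N" using K by blast
    have "\<pi> (u \<oplus> \<ominus> v) = \<pi> u \<oplus>\<^bsub>M\<^esub> \<pi> (\<ominus> v)" using u vN Nc by (simp add: add)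
    also have "\<dots> = \<pi> (v \<oplus> \<ominus> v)" using v vN Nc by (simp add: add)
    also have "v \<oplus> \<ominus> v = \<zero>" using NR[OF vN] by (rule r_neg)
    finally have "u \<oplus> \<ominus> v \<in> P" using ker[of "u \<oplus> \<ominus> v"] u vN Nc by blast
    then have "u \<oplus> \<ominus> v \<in> K" using K by blast
    then have "(u \<oplus> \<ominus> v) \<oplus> v \<in> K" using v(1) by (rule ideal_add_closed[OF K(1)])
    moreover have "(u \<oplus> \<ominus> v) \<oplus> v = u" using NR u vN by (simp add: a_assoc l_neg)
    ultimately show ?thesis by simp
  qed
  show ?thesis
    unfolding module_length_eq_height
  proof (rule antisym)
    show "height {L. submodule L R M} \<le> height {K. ideal K R \<and> P \<subseteq> K \<and> K \<subseteq> N}"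
    proof (rule height_le_of_strict_mono[where f = "\<lambda>L. {u \<in> N. \<pi> u \<in> L}"])
      show "{u \<in> N. \<pi> u \<in> L} \<in> {K. ideal K R \<and> P \<subseteq> K \<and> K \<subseteq> N}"
        if "L \<in> {L. submodule L R M}" for L using pull that by simp
    next
      fix L L' assume L: "L \<in> {L. submodule L R M}" "L' \<in> {L. submodule L R M}" "L \<subset> L'"
      then have "L' \<subseteq> carrier M"
        using subgroup.subset[OF submodule.axioms(1)[of L' R M]] by simp
      then show "{u \<in> N. \<pi> u \<in> L} \<subset> {u \<in> N. \<pi> u \<in> L'}"
        using L(3) unfolding surj by blast
    qed
    show "height {K. ideal K R \<and> P \<subseteq> K \<and> K \<subseteq> N} \<le> height {L. submodule L R M}"
    proof (rule height_le_of_strict_mono[where f = "\<lambda>K. \<pi> ` K"])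
      show "\<pi> ` K \<in> {L. submodule L R M}" if "K \<in> {K. ideal K R \<and> P \<subseteq> K \<and> K \<subseteq> N}" for K
        using push that by simp
    next
      fix K K' assume "K \<in> {K. ideal K R \<and> P \<subseteq> K \<and> K \<subseteq> N}"
        "K' \<in> {K. ideal K R \<and> P \<subseteq> K \<and> K \<subseteq> N}" "K \<subset> K'"
      then show "\<pi> ` K \<subset> \<pi> ` K'" using saturated[of K] by blast
    qed
  qed
qed

text \<open>
  Ideals may be pushed into the total ring of fractions by \<open>u \<mapsto> u/x\<close> with a fixed denominator,
  which is linear and injective; the cosets of \<open>P/x\<close> are then the images of the cosets of \<open>P\<close>.
\<close>
lemma frac_length_eq_height_ideals:
  assumes P: "ideal P R" and N: "ideal N R" and PN: "P \<subseteq> N" and x: "x \<in> regular_elems R"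
  shows "frac_length R ((\<lambda>u. fraction R u x) ` N) ((\<lambda>u. fraction R u x) ` P)
    = height {K. ideal K R \<and> P \<subseteq> K \<and> K \<subseteq> N}"
proof -
  define q where "q = (\<lambda>u. fraction R u x)"
  define \<pi> where "\<pi> = (\<lambda>u. q ` (P +> u))"
  interpret P: ideal P R by fact
  have PR: "u \<in> carrier R" if "u \<in> P" for u using P.Icarr that .
  have NR: "u \<in> carrier R" if "u \<in> N" for u using ideal.Icarr[OF N that] .
  have cosetR: "P +> u \<subseteq> carrier R" if "u \<in> carrier R" for u
    using that P.a_subset by (rule a_r_coset_subset_G[rotated])
  have q_add: "q u \<oplus>\<^bsub>total_frac R\<^esub> q v = q (u \<oplus> v)" if "u \<in> carrier R" "v \<in> carrier R" for u v
    unfolding q_def by (rule fraction_add_same_denominator) (use that x in auto)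
  have q_smult: "c \<odot>\<^bsub>total_frac R\<^esub> q u = q (c \<otimes> u)" if "u \<in> carrier R" "c \<in> carrier R" for u c
    unfolding q_def by (rule fraction_smult) (use that x in auto)
  have q_inj: "q u = q v \<longleftrightarrow> u = v" if "u \<in> carrier R" "v \<in> carrier R" for u v
    unfolding q_def using fraction_inject that x by simp
  have coset: "q ` P +>\<^bsub>total_frac R\<^esub> q u = \<pi> u" if "u \<in> carrier R" for u
    unfolding a_r_coset_def' \<pi>_def using q_add[OF PR that] by auto
  let ?M = "quot_module (total_frac R) (q ` N) (q ` P)"
  have "module_length R ?M = height {K. ideal K R \<and> P \<subseteq> K \<and> K \<subseteq> N}"
  proof (rule module_length_eq_height_ideals[OF N PN])
    have "carrier ?M = (\<Union>a\<in>q ` N. {q ` P +>\<^bsub>total_frac R\<^esub> a})"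
      by (simp add: quot_module_def A_RCOSETS_def' a_r_coset_def')
    also have "\<dots> = \<pi> ` N" using coset NR by auto
    finally show "carrier ?M = \<pi> ` N" .
  next
    fix u v assume uv: "u \<in> N" "v \<in> N"
    note uvR = NR[OF uv(1)] NR[OF uv(2)]
    have "\<pi> u \<oplus>\<^bsub>?M\<^esub> \<pi> v = (\<Union>a\<in>P +> u. \<Union>b\<in>P +> v. {q a \<oplus>\<^bsub>total_frac R\<^esub> q b})"
      by (auto simp: quot_module_def set_add_def' \<pi>_def)
    also have "\<dots> = (\<Union>a\<in>P +> u. \<Union>b\<in>P +> v. {q (a \<oplus> b)})"
      using q_add cosetR[OF uvR(1)] cosetR[OF uvR(2)] by (intro SUP_cong refl) (simp add: subset_iff)
    also have "\<dots> = q ` ((P +> u) <+> (P +> v))" by (auto simp: set_add_def')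
    also have "(P +> u) <+> (P +> v) = P +> (u \<oplus> v)" using P.a_rcos_sum[OF uvR] .
    finally show "\<pi> u \<oplus>\<^bsub>?M\<^esub> \<pi> v = \<pi> (u \<oplus> v)" unfolding \<pi>_def .
  next
    fix c u assume c: "c \<in> carrier R" and u: "u \<in> N"
    have *: "q ` P +>\<^bsub>total_frac R\<^esub> (c \<odot>\<^bsub>total_frac R\<^esub> q a) = \<pi> (c \<otimes> u)" if a: "a \<in> P +> u" for a
    proof -
      obtain p where p: "p \<in> P" "a = p \<oplus> u" using a unfolding a_r_coset_def' by blast
      have aR: "a \<in> carrier R" using cosetR[OF NR[OF u]] a by blast
      have "c \<otimes> a = c \<otimes> p \<oplus> c \<otimes> u" using p c PR NR[OF u] by (simp add: r_distr)
      then have "c \<otimes> a \<in> P +> (c \<otimes> u)"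
        using P.I_l_closed[OF p(1) c] unfolding a_r_coset_def' by blast
      then have "P +> (c \<otimes> a) = P +> (c \<otimes> u)"
        using P.a_repr_independence'[of "c \<otimes> a" "c \<otimes> u"] c NR[OF u] by simp
      then show ?thesis using coset[of "c \<otimes> a"] q_smult[OF aR c] c aR by (simp add: \<pi>_def)
    qed
    have "c \<odot>\<^bsub>?M\<^esub> \<pi> u = (\<Union>a\<in>P +> u. q ` P +>\<^bsub>total_frac R\<^esub> (c \<odot>\<^bsub>total_frac R\<^esub> q a))"
      by (simp add: quot_module_def \<pi>_def)
    also have "\<dots> = \<pi> (c \<otimes> u)"
      by (rule UN_constant_eq[OF P.a_rcos_self[OF NR[OF u]]]) (use * in blast)
    finally show "c \<odot>\<^bsub>?M\<^esub> \<pi> u = \<pi> (c \<otimes> u)" .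
  next
    have \<pi>0: "\<pi> \<zero> = q ` P" unfolding \<pi>_def using P.a_subset by simp
    then show "\<zero>\<^bsub>?M\<^esub> = \<pi> \<zero>" by (simp add: quot_module_def)
    fix u assume u: "u \<in> N"
    show "\<pi> u = \<pi> \<zero> \<longleftrightarrow> u \<in> P"
    proof
      assume "\<pi> u = \<pi> \<zero>"
      moreover have "q u \<in> \<pi> u" unfolding \<pi>_def using P.a_rcos_self[OF NR[OF u]] by blast
      ultimately obtain v where "v \<in> P" "q u = q v" unfolding \<pi>0 by blast
      then show "u \<in> P" using q_inj NR[OF u] PR by metis
    next
      assume "u \<in> P"
      then have "P +> u = P" by (rule P.a_rcos_const)
      then show "\<pi> u = \<pi> \<zero>" unfolding \<pi>0 by (simp add: \<pi>_def)
    qed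
  qed
  then show ?thesis unfolding q_def .
qed


lemma ideal_scaled:
  assumes J: "ideal J R" and x: "x \<in> carrier R"
  shows "ideal ((\<otimes>) x ` J) R"
proof (rule ideal_of_closed)
  have JR: "u \<in> carrier R" if "u \<in> J" for u using ideal.Icarr[OF J that] .
  show "(\<otimes>) x ` J \<subseteq> carrier R" using JR x by auto
  show "\<zero> \<in> (\<otimes>) x ` J" using ideal_zero_mem[OF J] x by (metis imageI r_null)
  show "u \<oplus> v \<in> (\<otimes>) x ` J" if uv: "u \<in> (\<otimes>) x ` J" "v \<in> (\<otimes>) x ` J" for u v
  proof -
    obtain i j where "i \<in> J" "u = x \<otimes> i" "j \<in> J" "v = x \<otimes> j" using uv by blast
    then have "u \<oplus> v = x \<otimes> (i \<oplus> j)" "i \<oplus> j \<in> J"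
      using x JR ideal_add_closed[OF J] by (simp_all add: r_distr)
    then show ?thesis by blast
  qed
  show "r \<otimes> u \<in> (\<otimes>) x ` J" if r: "r \<in> carrier R" and u: "u \<in> (\<otimes>) x ` J" for r u
  proof -
    obtain i where i: "i \<in> J" "u = x \<otimes> i" using u by blast
    then have "r \<otimes> u = x \<otimes> (r \<otimes> i)" using x r JR[OF i(1)] by (simp add: m_lcomm)
    moreover have "r \<otimes> i \<in> J" using ideal.I_l_closed[OF J i(1) r] .
    ultimately show ?thesis by blast
  qed
qed

lemma ideal_quotient:
  assumes J: "ideal J R" and K: "K \<subseteq> carrier R"
  shows "ideal {u \<in> carrier R. \<forall>k\<in>K. u \<otimes> k \<in> J} R"
proof (rule ideal_of_closed)
  have KR: "k \<in> carrier R" if "k \<in> K" for k using K that by blast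
  show "\<zero> \<in> {u \<in> carrier R. \<forall>k\<in>K. u \<otimes> k \<in> J}"
    using KR ideal_zero_mem[OF J] by simp
  show "u \<oplus> v \<in> {u \<in> carrier R. \<forall>k\<in>K. u \<otimes> k \<in> J}"
    if "u \<in> {u \<in> carrier R. \<forall>k\<in>K. u \<otimes> k \<in> J}" "v \<in> {u \<in> carrier R. \<forall>k\<in>K. u \<otimes> k \<in> J}" for u v
    using that KR ideal_add_closed[OF J] by (simp add: l_distr)
  show "r \<otimes> u \<in> {u \<in> carrier R. \<forall>k\<in>K. u \<otimes> k \<in> J}"
    if "r \<in> carrier R" "u \<in> {u \<in> carrier R. \<forall>k\<in>K. u \<otimes> k \<in> J}" for r u
    using that KR ideal.I_l_closed[OF J] by (simp add: m_assoc)
qed blast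

lemma frac_length_colon:
  assumes J: "ideal J R" and K: "K \<subseteq> carrier R" and x: "x \<in> K" "x \<in> regular_elems R"
    and JK: "\<And>j k. j \<in> J \<Longrightarrow> k \<in> K \<Longrightarrow> j \<otimes> k \<in> J"
  shows "frac_length R (colon R (frac_embed R ` J) (frac_embed R ` K)) (frac_embed R ` J)
    = height {L. ideal L R \<and> (\<otimes>) x ` J \<subseteq> L \<and> L \<subseteq> {u \<in> carrier R. \<forall>k\<in>K. u \<otimes> k \<in> (\<otimes>) x ` J}}"
proof -
  have xc: "x \<in> carrier R" using x by auto
  have JR: "u \<in> carrier R" if "u \<in> J" for u using ideal.Icarr[OF J that] .
  have J_sub: "J \<subseteq> carrier R" using JR by blast
  have "(\<otimes>) x ` J \<subseteq> {u \<in> carrier R. \<forall>k\<in>K. u \<otimes> k \<in> (\<otimes>) x ` J}"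
    using JR xc K JK by (auto simp: m_assoc subset_iff)
  then show ?thesis
    unfolding colon_eq_fractions[OF J_sub K x]
    unfolding frac_embed_image_eq_fractions[OF J_sub x(2)]
    using J K xc x(2) by (intro frac_length_eq_height_ideals ideal_scaled ideal_quotient)
qed

section \<open>The type of a local ring\<close>

text \<open>
  An ideal whose complement consists of units contains every proper ideal. This is how the maximal
  ideal over which the type is formed gets identified.
\<close>
lemma maximalideal_iff_of_nonunits:
  assumes M: "ideal M R" "\<one> \<notin> M" "carrier R - M \<subseteq> Units R"
  shows "maximalideal J R \<longleftrightarrow> J = M"
proof
  have proper: "J \<subseteq> M" if J: "ideal J R" "J \<noteq> carrier R" for J
  proof
    fix u assume u: "u \<in> J"
    show "u \<in> M"
    proof (rule ccontr)
      assume "u \<notin> M"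
      then have "u \<in> Units R" using M(3) ideal.Icarr[OF J(1) u] by blast
      then have "\<one> \<in> J" using ideal.I_l_closed[OF J(1) u, of "inv u"] by simp
      then show False using ideal.one_imp_carrier[OF J(1)] J(2) by blast
    qed
  qed
  have Mc: "M \<noteq> carrier R" using M(2) by auto
  {
    assume "maximalideal J R"
    then interpret J: maximalideal J R .
    have "M \<subseteq> carrier R" using ideal.Icarr[OF M(1)] by blast
    then show "J = M"
      using J.I_maximal[OF M(1)] proper[OF J.is_ideal J.I_notcarr[symmetric]] Mc by blast
  }
  show "maximalideal J R" if "J = M"
    unfolding that
  proof (rule maximalidealI[OF M(1)])
    show "carrier R \<noteq> M" using Mc by blast
    show "K = M \<or> K = carrier R" if "ideal K R" "M \<subseteq> K" "K \<subseteq> carrier R" for K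
      using proper that by blast
  qed
qed

lemma cm_type_eq_height:
  assumes M: "ideal M R" "\<one> \<notin> M" "carrier R - M \<subseteq> Units R" and x: "x \<in> M" "x \<in> regular_elems R"
  shows "cm_type R = height {L. ideal L R \<and> (\<otimes>) x ` carrier R \<subseteq> L
    \<and> L \<subseteq> {u \<in> carrier R. \<forall>m\<in>M. u \<otimes> m \<in> (\<otimes>) x ` carrier R}}"
proof -
  have "(THE M. maximalideal M R) = M"
    using maximalideal_iff_of_nonunits[OF M] by simp
  moreover have "M \<subseteq> carrier R" using ideal.Icarr[OF M(1)] by blast
  ultimately show ?thesis
    unfolding cm_type_def Let_def using frac_length_colon[OF oneideal _ x] by (auto simp: subset_iff)
qed

end

lemma ring_iso_image_ideal:
  assumes "cring R" "cring S" and f: "f \<in> ring_iso R S" and K: "ideal K R"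
  shows "ideal (f ` K) S"
proof -
  interpret R: cring R by fact
  interpret S: cring S by fact
  interpret f: ring_hom_cring R S f
    using f by unfold_locales (simp add: ring_iso_def)
  have surj: "f ` carrier R = carrier S"
    using f by (simp add: ring_iso_def bij_betw_def)
  have KR: "u \<in> carrier R" if "u \<in> K" for u using ideal.Icarr[OF K that] .
  show ?thesis
  proof (rule S.ideal_of_closed)
    show "f ` K \<subseteq> carrier S" using KR by auto
    show "\<zero>\<^bsub>S\<^esub> \<in> f ` K" using R.ideal_zero_mem[OF K] f.hom_zero by (metis imageI)
    show "a \<oplus>\<^bsub>S\<^esub> b \<in> f ` K" if "a \<in> f ` K" "b \<in> f ` K" for a b
      using that KR R.ideal_add_closed[OF K] by (auto simp flip: f.hom_add)
    show "r \<otimes>\<^bsub>S\<^esub> a \<in> f ` K" if r: "r \<in> carrier S" and a: "a \<in> f ` K" for r a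
    proof -
      obtain s u where "s \<in> carrier R" "r = f s" "u \<in> K" "a = f u" using r a surj by blast
      then show ?thesis using KR ideal.I_l_closed[OF K] by (auto simp flip: f.hom_mult)
    qed
  qed
qed

lemma height_ideals_image_le:
  assumes RS: "cring R" "cring S" and f: "f \<in> ring_iso R S" and N: "N \<subseteq> carrier R"
  shows "height {L. ideal L R \<and> P \<subseteq> L \<and> L \<subseteq> N} \<le> height {L. ideal L S \<and> f ` P \<subseteq> L \<and> L \<subseteq> f ` N}"
proof (rule height_le_of_strict_mono[where f = "\<lambda>L. f ` L"])
  fix L assume "L \<in> {L. ideal L R \<and> P \<subseteq> L \<and> L \<subseteq> N}"
  then show "f ` L \<in> {L. ideal L S \<and> f ` P \<subseteq> L \<and> L \<subseteq> f ` N}"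
    using ring_iso_image_ideal[OF RS f] by (simp add: image_mono)
next
  fix L L' assume "L \<in> {L. ideal L R \<and> P \<subseteq> L \<and> L \<subseteq> N}"
    "L' \<in> {L. ideal L R \<and> P \<subseteq> L \<and> L \<subseteq> N}" and LL: "L \<subset> L'"
  then have "L' \<subseteq> carrier R" using N by auto
  then have "inj_on f L'"
    using f by (auto simp: ring_iso_def bij_betw_def intro: inj_on_subset)
  then show "f ` L \<subset> f ` L'" by (rule image_strict_mono[OF _ LL])
qed

lemma height_ideals_image:
  assumes RS: "cring R" "cring S" and f: "f \<in> ring_iso R S"
    and P: "P \<subseteq> carrier R" and N: "N \<subseteq> carrier R"
  shows "height {L. ideal L S \<and> f ` P \<subseteq> L \<and> L \<subseteq> f ` N} = height {L. ideal L R \<and> P \<subseteq> L \<and> L \<subseteq> N}"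
proof (rule antisym)
  let ?g = "inv_into (carrier R) f"
  have bij: "bij_betw f (carrier R) (carrier S)" using f by (simp add: ring_iso_def)
  have g: "?g \<in> ring_iso S R"
    by (rule ring_iso_set_sym[OF cring.axioms(1)[OF RS(1)] f])
  have gf: "?g ` f ` A = A" if "A \<subseteq> carrier R" for A
    using bij that by (simp add: bij_betw_def inv_into_image_cancel)
  have "f ` N \<subseteq> carrier S" using bij N by (auto simp: bij_betw_def)
  from height_ideals_image_le[OF RS(2,1) g this, of "f ` P"]
  show "height {L. ideal L S \<and> f ` P \<subseteq> L \<and> L \<subseteq> f ` N} \<le> height {L. ideal L R \<and> P \<subseteq> L \<and> L \<subseteq> N}"
    unfolding gf[OF P] gf[OF N] .
qed (rule height_ideals_image_le[OF RS f N])

text \<open>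
  The quotient of the Rees algebra is a ring of cosets, whereas computations take place in an
  isomorphic ring of pairs. Once the type is expressed by ideals of the ring itself, it is visibly
  transported by isomorphisms.
\<close>
lemma cm_type_iso:
  assumes "cring R" "cring S" and f: "f \<in> ring_iso R S"
    and M: "ideal M R" "\<one>\<^bsub>R\<^esub> \<notin> M" "carrier R - M \<subseteq> Units R" and x: "x \<in> M" "x \<in> regular_elems R"
  shows "cm_type S = cm_type R"
proof -
  interpret R: cring R by fact
  interpret S: cring S by fact
  interpret f: ring_hom_cring R S f
    using f by unfold_locales (simp add: ring_iso_def)
  have inj: "f u = f v \<longleftrightarrow> u = v" if "u \<in> carrier R" "v \<in> carrier R" for u v
    using f that by (auto simp: ring_iso_def bij_betw_def inj_on_def)
  have surj: "f ` carrier R = carrier S"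
    using f by (simp add: ring_iso_def bij_betw_def)
  note push = ring_iso_image_ideal[OF assms(1-3)]
  have MR: "u \<in> carrier R" if "u \<in> M" for u using ideal.Icarr[OF M(1) that] .
  have one: "\<one>\<^bsub>S\<^esub> \<notin> f ` M"
    using M(2) MR inj[OF R.one_closed] by auto
  have units: "carrier S - f ` M \<subseteq> Units S"
  proof
    fix a assume a: "a \<in> carrier S - f ` M"
    then obtain u where u: "u \<in> carrier R" "a = f u" "u \<notin> M" using surj by blast
    then have "u \<in> Units R" using M(3) by blast
    then obtain v where v: "v \<in> carrier R" "v \<otimes>\<^bsub>R\<^esub> u = \<one>\<^bsub>R\<^esub>" "u \<otimes>\<^bsub>R\<^esub> v = \<one>\<^bsub>R\<^esub>"
      unfolding Units_def by blast
    then have "f v \<otimes>\<^bsub>S\<^esub> f u = \<one>\<^bsub>S\<^esub>" "f u \<otimes>\<^bsub>S\<^esub> f v = \<one>\<^bsub>S\<^esub>"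
      using u by (simp_all flip: f.hom_mult)
    then show "a \<in> Units S" unfolding Units_def using u v by auto
  qed
  have xc: "x \<in> carrier R" using x by auto
  have "b = \<zero>\<^bsub>S\<^esub>" if b: "b \<in> carrier S" "f x \<otimes>\<^bsub>S\<^esub> b = \<zero>\<^bsub>S\<^esub>" for b
  proof -
    obtain u where u: "u \<in> carrier R" "b = f u" using b surj by blast
    then have "f (x \<otimes>\<^bsub>R\<^esub> u) = f \<zero>\<^bsub>R\<^esub>" using b(2) xc by simp
    then have "x \<otimes>\<^bsub>R\<^esub> u = \<zero>\<^bsub>R\<^esub>"
      using inj[of "x \<otimes>\<^bsub>R\<^esub> u" "\<zero>\<^bsub>R\<^esub>"] R.m_closed[OF xc u(1)] by blast
    then have "u = \<zero>\<^bsub>R\<^esub>" by (rule R.regular_elemsD[OF x(2) u(1)])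
    then show ?thesis using u(2) by simp
  qed
  then have fx: "f x \<in> regular_elems S" using xc by (simp add: regular_elems_def)
  let ?P = "(\<otimes>\<^bsub>R\<^esub>) x ` carrier R"
  let ?N = "{u \<in> carrier R. \<forall>m\<in>M. u \<otimes>\<^bsub>R\<^esub> m \<in> ?P}"
  have mem: "f u \<in> f ` A \<longleftrightarrow> u \<in> A" if "u \<in> carrier R" "A \<subseteq> carrier R" for u A
    using that inj by (metis (no_types, lifting) image_iff subsetD)
  have P: "(\<otimes>\<^bsub>S\<^esub>) (f x) ` carrier S = f ` ?P"
    unfolding surj[symmetric] image_image using xc by (intro image_cong) simp_all
  have PR: "?P \<subseteq> carrier R" using xc by auto
  have N: "{b \<in> carrier S. \<forall>m\<in>f ` M. b \<otimes>\<^bsub>S\<^esub> m \<in> f ` ?P} = f ` ?N"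
  proof -
    have "f u \<otimes>\<^bsub>S\<^esub> f m \<in> f ` ?P \<longleftrightarrow> u \<otimes>\<^bsub>R\<^esub> m \<in> ?P" if "u \<in> carrier R" "m \<in> M" for u m
      using mem[of "u \<otimes>\<^bsub>R\<^esub> m", OF _ PR] that MR by simp
    then show ?thesis unfolding surj[symmetric] by auto
  qed
  have "cm_type S = height {L. ideal L S \<and> f ` ?P \<subseteq> L \<and> L \<subseteq> f ` ?N}"
    using S.cm_type_eq_height[OF push[OF M(1)] one units imageI[OF x(1)] fx] unfolding P N .
  also have "\<dots> = height {L. ideal L R \<and> ?P \<subseteq> L \<and> L \<subseteq> ?N}"
    by (rule height_ideals_image[OF assms(1-3) PR]) simp
  also have "\<dots> = cm_type R" by (rule R.cm_type_eq_height[OF M x, symmetric])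
  finally show ?thesis .
qed

section \<open>The quadratic extension as pairs\<close>

text \<open>
  The ring \<open>R[t]/(t\<^sup>2 + at + b)\<close>, free over \<open>R\<close> with basis \<open>1, t\<close>: the pair \<open>(x, y)\<close> stands for
  \<open>x + y t\<close>, and products are reduced by \<open>t\<^sup>2 = - a t - b\<close>.
\<close>
definition quad_ext :: "('a, 'm) ring_scheme \<Rightarrow> 'a \<Rightarrow> 'a \<Rightarrow> ('a \<times> 'a) ring"
  where "quad_ext R a b =
    \<lparr>carrier = carrier R \<times> carrier R,
     mult = (\<lambda>(x, y) (u, v). (x \<otimes>\<^bsub>R\<^esub> u \<ominus>\<^bsub>R\<^esub> b \<otimes>\<^bsub>R\<^esub> (y \<otimes>\<^bsub>R\<^esub> v),
       x \<otimes>\<^bsub>R\<^esub> v \<oplus>\<^bsub>R\<^esub> y \<otimes>\<^bsub>R\<^esub> u \<ominus>\<^bsub>R\<^esub> a \<otimes>\<^bsub>R\<^esub> (y \<otimes>\<^bsub>R\<^esub> v))),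
     one = (\<one>\<^bsub>R\<^esub>, \<zero>\<^bsub>R\<^esub>),
     zero = (\<zero>\<^bsub>R\<^esub>, \<zero>\<^bsub>R\<^esub>),
     add = (\<lambda>(x, y) (u, v). (x \<oplus>\<^bsub>R\<^esub> u, y \<oplus>\<^bsub>R\<^esub> v))\<rparr>"

lemma quad_ext_simps [simp]:
  "carrier (quad_ext R a b) = carrier R \<times> carrier R"
  "\<one>\<^bsub>quad_ext R a b\<^esub> = (\<one>\<^bsub>R\<^esub>, \<zero>\<^bsub>R\<^esub>)"
  "\<zero>\<^bsub>quad_ext R a b\<^esub> = (\<zero>\<^bsub>R\<^esub>, \<zero>\<^bsub>R\<^esub>)"
  "(x, y) \<oplus>\<^bsub>quad_ext R a b\<^esub> (u, v) = (x \<oplus>\<^bsub>R\<^esub> u, y \<oplus>\<^bsub>R\<^esub> v)"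
  "(x, y) \<otimes>\<^bsub>quad_ext R a b\<^esub> (u, v) = (x \<otimes>\<^bsub>R\<^esub> u \<ominus>\<^bsub>R\<^esub> b \<otimes>\<^bsub>R\<^esub> (y \<otimes>\<^bsub>R\<^esub> v),
     x \<otimes>\<^bsub>R\<^esub> v \<oplus>\<^bsub>R\<^esub> y \<otimes>\<^bsub>R\<^esub> u \<ominus>\<^bsub>R\<^esub> a \<otimes>\<^bsub>R\<^esub> (y \<otimes>\<^bsub>R\<^esub> v))"
  by (simp_all add: quad_ext_def)

lemma (in cring) quad_ext_cring:
  assumes ab: "a \<in> carrier R" "b \<in> carrier R"
  shows "cring (quad_ext R a b)"
proof (rule cringI)
  show "abelian_group (quad_ext R a b)"
  proof (rule abelian_groupI)
    fix p assume "p \<in> carrier (quad_ext R a b)"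
    then show "\<exists>q\<in>carrier (quad_ext R a b). q \<oplus>\<^bsub>quad_ext R a b\<^esub> p = \<zero>\<^bsub>quad_ext R a b\<^esub>"
      by (cases p) (auto simp: l_neg intro!: bexI[of _ "(\<ominus> fst p, \<ominus> snd p)"])
  qed (auto simp: a_ac)
  show "comm_monoid (quad_ext R a b)"
  proof (rule comm_monoidI)
    fix p q r
    assume "p \<in> carrier (quad_ext R a b)" "q \<in> carrier (quad_ext R a b)" "r \<in> carrier (quad_ext R a b)"
    then obtain x y u v w z where [simp]: "p = (x, y)" "q = (u, v)" "r = (w, z)"
      and c: "x \<in> carrier R" "y \<in> carrier R" "u \<in> carrier R" "v \<in> carrier R" "w \<in> carrier R" "z \<in> carrier R"
      by (cases p; cases q; cases r) auto
    have "(x \<otimes> u \<ominus> b \<otimes> (y \<otimes> v)) \<otimes> w \<ominus> b \<otimes> ((x \<otimes> v \<oplus> y \<otimes> u \<ominus> a \<otimes> (y \<otimes> v)) \<otimes> z)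
      = x \<otimes> (u \<otimes> w \<ominus> b \<otimes> (v \<otimes> z)) \<ominus> b \<otimes> (y \<otimes> (u \<otimes> z \<oplus> v \<otimes> w \<ominus> a \<otimes> (v \<otimes> z)))"
      using ab c by algebra
    moreover have "(x \<otimes> u \<ominus> b \<otimes> (y \<otimes> v)) \<otimes> z \<oplus> (x \<otimes> v \<oplus> y \<otimes> u \<ominus> a \<otimes> (y \<otimes> v)) \<otimes> w
        \<ominus> a \<otimes> ((x \<otimes> v \<oplus> y \<otimes> u \<ominus> a \<otimes> (y \<otimes> v)) \<otimes> z)
      = x \<otimes> (u \<otimes> z \<oplus> v \<otimes> w \<ominus> a \<otimes> (v \<otimes> z)) \<oplus> y \<otimes> (u \<otimes> w \<ominus> b \<otimes> (v \<otimes> z))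
        \<ominus> a \<otimes> (y \<otimes> (u \<otimes> z \<oplus> v \<otimes> w \<ominus> a \<otimes> (v \<otimes> z)))"
      using ab c by algebra
    ultimately show "p \<otimes>\<^bsub>quad_ext R a b\<^esub> q \<otimes>\<^bsub>quad_ext R a b\<^esub> r
      = p \<otimes>\<^bsub>quad_ext R a b\<^esub> (q \<otimes>\<^bsub>quad_ext R a b\<^esub> r)" by simp
  next
    fix p q assume "p \<in> carrier (quad_ext R a b)" "q \<in> carrier (quad_ext R a b)"
    then show "p \<otimes>\<^bsub>quad_ext R a b\<^esub> q = q \<otimes>\<^bsub>quad_ext R a b\<^esub> p"
      by (cases p; cases q) (auto simp: m_comm a_comm)
  qed (use ab in \<open>auto simp: minus_eq\<close>)
next
  fix p q r
  assume "p \<in> carrier (quad_ext R a b)" "q \<in> carrier (quad_ext R a b)" "r \<in> carrier (quad_ext R a b)"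
  then obtain x y u v w z where [simp]: "p = (x, y)" "q = (u, v)" "r = (w, z)"
    and c: "x \<in> carrier R" "y \<in> carrier R" "u \<in> carrier R" "v \<in> carrier R" "w \<in> carrier R" "z \<in> carrier R"
    by (cases p; cases q; cases r) auto
  have "(x \<oplus> u) \<otimes> w \<ominus> b \<otimes> ((y \<oplus> v) \<otimes> z)
    = x \<otimes> w \<ominus> b \<otimes> (y \<otimes> z) \<oplus> (u \<otimes> w \<ominus> b \<otimes> (v \<otimes> z))"
    using ab c by algebra
  moreover have "(x \<oplus> u) \<otimes> z \<oplus> (y \<oplus> v) \<otimes> w \<ominus> a \<otimes> ((y \<oplus> v) \<otimes> z)
    = x \<otimes> z \<oplus> y \<otimes> w \<ominus> a \<otimes> (y \<otimes> z) \<oplus> (u \<otimes> z \<oplus> v \<otimes> w \<ominus> a \<otimes> (v \<otimes> z))"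
    using ab c by algebra
  ultimately show "(p \<oplus>\<^bsub>quad_ext R a b\<^esub> q) \<otimes>\<^bsub>quad_ext R a b\<^esub> r
    = p \<otimes>\<^bsub>quad_ext R a b\<^esub> r \<oplus>\<^bsub>quad_ext R a b\<^esub> q \<otimes>\<^bsub>quad_ext R a b\<^esub> r" by simp
qed

text \<open>
  The subring \<open>R + I t\<close>, the normal form of the quotient of the Rees algebra.
\<close>
definition quad_sub :: "('a, 'm) ring_scheme \<Rightarrow> 'a set \<Rightarrow> 'a \<Rightarrow> 'a \<Rightarrow> ('a \<times> 'a) ring"
  where "quad_sub R I a b = (quad_ext R a b)\<lparr>carrier := carrier R \<times> I\<rparr>"

lemma quad_sub_simps [simp]:
  "carrier (quad_sub R I a b) = carrier R \<times> I"
  "\<one>\<^bsub>quad_sub R I a b\<^esub> = (\<one>\<^bsub>R\<^esub>, \<zero>\<^bsub>R\<^esub>)"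
  "\<zero>\<^bsub>quad_sub R I a b\<^esub> = (\<zero>\<^bsub>R\<^esub>, \<zero>\<^bsub>R\<^esub>)"
  "(x, y) \<oplus>\<^bsub>quad_sub R I a b\<^esub> (u, v) = (x \<oplus>\<^bsub>R\<^esub> u, y \<oplus>\<^bsub>R\<^esub> v)"
  "(x, y) \<otimes>\<^bsub>quad_sub R I a b\<^esub> (u, v) = (x \<otimes>\<^bsub>R\<^esub> u \<ominus>\<^bsub>R\<^esub> b \<otimes>\<^bsub>R\<^esub> (y \<otimes>\<^bsub>R\<^esub> v),
     x \<otimes>\<^bsub>R\<^esub> v \<oplus>\<^bsub>R\<^esub> y \<otimes>\<^bsub>R\<^esub> u \<ominus>\<^bsub>R\<^esub> a \<otimes>\<^bsub>R\<^esub> (y \<otimes>\<^bsub>R\<^esub> v))"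
  by (simp_all add: quad_sub_def quad_ext_def)

context cring
begin

lemma ideal_diff_closed: "ideal K R \<Longrightarrow> u \<in> K \<Longrightarrow> v \<in> K \<Longrightarrow> u \<ominus> v \<in> K"
  by (simp add: minus_eq ideal_add_closed ideal_neg_closed)

lemma quad_sub_cring:
  assumes I: "ideal I R" and ab: "a \<in> carrier R" "b \<in> carrier R"
  shows "cring (quad_sub R I a b)" and "subring (carrier R \<times> I) (quad_ext R a b)"
proof -
  interpret T: cring "quad_ext R a b" using quad_ext_cring[OF ab] .
  have IR: "u \<in> carrier R" if "u \<in> I" for u using ideal.Icarr[OF I that] .
  note Ic = ideal_add_closed[OF I] ideal_neg_closed[OF I] ideal_zero_mem[OF I]
    ideal.I_l_closed[OF I] ideal.I_r_closed[OF I] ideal_diff_closed[OF I]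
  have neg: "\<ominus>\<^bsub>quad_ext R a b\<^esub> (u, v) = (\<ominus> u, \<ominus> v)" if "u \<in> carrier R" "v \<in> carrier R" for u v
    by (rule T.minus_equality) (use that in \<open>simp_all add: l_neg\<close>)
  show sub: "subring (carrier R \<times> I) (quad_ext R a b)"
    by (rule T.subringI) (use IR Ic ab neg in auto)
  have "carrier R \<times> I \<subseteq> carrier (quad_ext R a b)" using IR by auto
  then show "cring (quad_sub R I a b)"
    using T.subcringI'[OF sub] T.subcring_iff unfolding quad_sub_def by blast
qed

end

section \<open>The type of the quadratic subring\<close>

locale quadratic_local = cring R + I: ideal I R + \<mm>: maximalideal \<mm> R
  for R (structure) and I \<mm> +
  fixes a b x
  assumes units: "carrier R - \<mm> \<subseteq> Units R" and I_sub: "I \<subseteq> \<mm>"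
    and ab: "a \<in> carrier R" "b \<in> carrier R"
    and xI: "x \<in> I" and xreg: "x \<in> regular_elems R"
begin

abbreviation "S \<equiv> quad_sub R I a b"

sublocale S: cring S by (rule quad_sub_cring(1)[OF I.is_ideal ab])

lemmas I_closed = ideal_add_closed[OF I.is_ideal] ideal_neg_closed[OF I.is_ideal]
  ideal_zero_mem[OF I.is_ideal] I.I_l_closed I.I_r_closed ideal_diff_closed[OF I.is_ideal]

lemmas \<mm>_closed = ideal_add_closed[OF \<mm>.is_ideal] ideal_neg_closed[OF \<mm>.is_ideal]
  ideal_zero_mem[OF \<mm>.is_ideal] \<mm>.I_l_closed \<mm>.I_r_closed ideal_diff_closed[OF \<mm>.is_ideal]

lemma x_carrier: "x \<in> carrier R" using xI by (rule I.Icarr)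

lemma ideal_quad_sub_maximal: "ideal (\<mm> \<times> I) S"
proof (rule S.ideal_of_closed)
  show "r \<otimes>\<^bsub>S\<^esub> u \<in> \<mm> \<times> I" if r: "r \<in> carrier S" and u: "u \<in> \<mm> \<times> I" for r u
  proof -
    obtain p i m j where [simp]: "r = (p, i)" "u = (m, j)"
      and c: "p \<in> carrier R" "i \<in> I" "m \<in> \<mm>" "j \<in> I" using r u by auto
    have "i \<in> carrier R" "j \<in> carrier R" "m \<in> carrier R" "j \<in> \<mm>" using c I_sub by auto
    then show ?thesis using c ab by (simp add: \<mm>_closed I_closed)
  qed
qed (auto simp: \<mm>_closed I_closed)

text \<open>
  The conjugate of \<open>r + i t\<close> under \<open>t \<mapsto> -a - t\<close> is \<open>(r - a i) - i t\<close>, so the product of both is the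
  norm \<open>r\<^sup>2 - a r i + b i\<^sup>2\<close>. If \<open>r\<close> is a unit, then so is the norm, because \<open>I\<close> lies in the maximal
  ideal, and the inverse is the conjugate divided by the norm.
\<close>
lemma quad_sub_units: "carrier S - \<mm> \<times> I \<subseteq> Units S"
proof
  fix u assume "u \<in> carrier S - \<mm> \<times> I"
  then obtain r i where u: "u = (r, i)" and r: "r \<in> carrier R" "r \<notin> \<mm>" and i: "i \<in> I" by auto
  have iR: "i \<in> carrier R" using i by (rule I.Icarr)
  \<comment> \<open>the norm of \<open>r + i t\<close>\<close>
  define n where "n = r \<otimes> (r \<ominus> a \<otimes> i) \<oplus> b \<otimes> (i \<otimes> i)"
  have nR: "n \<in> carrier R" unfolding n_def using r iR ab by simp
  have "n \<notin> \<mm>"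
  proof
    assume "n \<in> \<mm>"
    moreover have "(a \<otimes> r \<ominus> b \<otimes> i) \<otimes> i \<in> \<mm>" using i I_sub r iR ab by (intro \<mm>.I_l_closed) auto
    ultimately have "n \<oplus> (a \<otimes> r \<ominus> b \<otimes> i) \<otimes> i \<in> \<mm>" by (rule \<mm>_closed(1))
    moreover have "n \<oplus> (a \<otimes> r \<ominus> b \<otimes> i) \<otimes> i = r \<otimes> r"
      unfolding n_def using r(1) iR ab by algebra
    ultimately show False
      using primeideal.I_prime[OF maximalideal_prime[OF \<mm>.is_maximalideal] r(1) r(1)] r(2) by auto
  qed
  then have nU: "n \<in> Units R" using units nR by blast
  have "(r, i) \<otimes>\<^bsub>S\<^esub> (r \<ominus> a \<otimes> i, \<ominus> i) = (n, \<zero>)"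
  proof -
    have "r \<otimes> (r \<ominus> a \<otimes> i) \<ominus> b \<otimes> (i \<otimes> \<ominus> i) = n"
      unfolding n_def using r(1) iR ab by algebra
    moreover have "r \<otimes> \<ominus> i \<oplus> i \<otimes> (r \<ominus> a \<otimes> i) \<ominus> a \<otimes> (i \<otimes> \<ominus> i) = \<zero>"
      using r(1) iR ab by algebra
    ultimately show ?thesis by simp
  qed
  moreover have "(n, \<zero>) \<otimes>\<^bsub>S\<^esub> (inv n, \<zero>) = \<one>\<^bsub>S\<^esub>"
    using nU nR ab by (simp add: minus_eq)
  ultimately have "(r, i) \<otimes>\<^bsub>S\<^esub> ((r \<ominus> a \<otimes> i, \<ominus> i) \<otimes>\<^bsub>S\<^esub> (inv n, \<zero>)) = \<one>\<^bsub>S\<^esub>"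
    using r i iR ab nU by (subst S.m_assoc[symmetric]) (auto simp: I_closed simp del: quad_sub_simps(2,5))
  moreover have "(r \<ominus> a \<otimes> i, \<ominus> i) \<otimes>\<^bsub>S\<^esub> (inv n, \<zero>) \<in> carrier S"
    using r i iR ab nU by (intro S.m_closed) (auto simp: I_closed)
  moreover have "u \<in> carrier S" using u r i by simp
  ultimately show "u \<in> Units S" unfolding u Units_def using S.m_comm by fastforce
qed

lemma quad_sub_regular: "(x, \<zero>) \<in> regular_elems S"
proof -
  have "u = \<zero>\<^bsub>S\<^esub>" if u: "u \<in> carrier S" and 0: "(x, \<zero>) \<otimes>\<^bsub>S\<^esub> u = \<zero>\<^bsub>S\<^esub>" for u
  proof -
    obtain p i where [simp]: "u = (p, i)" and c: "p \<in> carrier R" "i \<in> carrier R" using u by auto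
    have "x \<otimes> p = \<zero>" "x \<otimes> i = \<zero>" using 0 c x_carrier ab by (simp_all add: minus_eq)
    then show ?thesis using c regular_elemsD[OF xreg] by simp
  qed
  moreover have "(x, \<zero>) \<in> carrier S" using x_carrier I_closed by simp
  ultimately show ?thesis by (simp add: regular_elems_def del: quad_sub_simps)
qed

text \<open>
  These are \<open>x ((I : I) \<inter> (R : \<mm>))\<close> and \<open>x (I : \<mm>)\<close>, the two colons of the formula after clearing the
  denominator \<open>x\<close>.
\<close>
definition A where "A = {u \<in> carrier R. (\<forall>m\<in>\<mm>. u \<otimes> m \<in> (\<otimes>) x ` carrier R) \<and> (\<forall>i\<in>I. u \<otimes> i \<in> (\<otimes>) x ` I)}"

definition B where "B = {u \<in> carrier R. \<forall>m\<in>\<mm>. u \<otimes> m \<in> (\<otimes>) x ` I}"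

lemma scalar_mult:
  assumes "r \<in> carrier R" "p \<in> carrier R" "q \<in> carrier R"
  shows "(r, \<zero>) \<otimes>\<^bsub>S\<^esub> (p, q) = (r \<otimes> p, r \<otimes> q)"
  using assms ab by (simp add: minus_eq)

lemma principal_eq: "(\<otimes>\<^bsub>S\<^esub>) (x, \<zero>) ` carrier S = (\<otimes>) x ` carrier R \<times> (\<otimes>) x ` I"
proof -
  have "(x, \<zero>) \<otimes>\<^bsub>S\<^esub> (p, i) = (x \<otimes> p, x \<otimes> i)" if "p \<in> carrier R" "i \<in> I" for p i
    using that x_carrier by (intro scalar_mult) auto
  then show ?thesis by (force simp del: quad_sub_simps(5))
qed

lemmas xR_ideal = ideal_scaled[OF oneideal x_carrier]
lemmas xI_ideal = ideal_scaled[OF I.is_ideal x_carrier]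

lemma B_sub: "B \<subseteq> I"
proof
  fix u assume u: "u \<in> B"
  then have "u \<otimes> x \<in> (\<otimes>) x ` I" using xI I_sub by (auto simp: B_def)
  then obtain i where i: "i \<in> I" "u \<otimes> x = x \<otimes> i" by blast
  then have "u \<otimes> x = i \<otimes> x" using x_carrier by (simp add: m_comm)
  then have "u = i" using u i(1) xreg by (subst (asm) regular_r_cancel) (auto simp: B_def)
  then show "u \<in> I" using i by simp
qed

lemma xI_sub_xR: "(\<otimes>) x ` I \<subseteq> (\<otimes>) x ` carrier R" by auto

text \<open>
  Against \<open>m \<in> \<mm>\<close> and \<open>i t\<close> with \<open>i \<in> I\<close>, an element \<open>u + v t\<close> gives \<open>u m + v m t\<close> and
  \<open>- b v i + (u i - a v i) t\<close>; as \<open>I \<subseteq> \<mm>\<close>, the terms with \<open>a\<close> and \<open>b\<close> are in \<open>x I\<close> as soon as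
  \<open>v \<mm> \<subseteq> x I\<close>. This is where the dependence on \<open>a\<close> and \<open>b\<close> disappears.
\<close>
lemma colon_eq:
  "{u \<in> carrier S. \<forall>m\<in>\<mm> \<times> I. u \<otimes>\<^bsub>S\<^esub> m \<in> (\<otimes>\<^bsub>S\<^esub>) (x, \<zero>) ` carrier S} = A \<times> B"
proof (intro equalityI subsetI)
  fix p assume p: "p \<in> {u \<in> carrier S. \<forall>m\<in>\<mm> \<times> I. u \<otimes>\<^bsub>S\<^esub> m \<in> (\<otimes>\<^bsub>S\<^esub>) (x, \<zero>) ` carrier S}"
  then obtain u v where puv: "p = (u, v)" and uv: "u \<in> carrier R" "v \<in> I" by auto
  have vR: "v \<in> carrier R" using uv by auto
  have mem: "(u, v) \<otimes>\<^bsub>S\<^esub> (m, i) \<in> (\<otimes>) x ` carrier R \<times> (\<otimes>) x ` I" if "m \<in> \<mm>" "i \<in> I" for m i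
    using p that unfolding principal_eq puv by blast
  have m: "u \<otimes> m \<in> (\<otimes>) x ` carrier R" "v \<otimes> m \<in> (\<otimes>) x ` I" if "m \<in> \<mm>" for m
    using mem[OF that I_closed(3)] uv vR that ab \<mm>.Icarr[OF that] by (simp_all add: minus_eq)
  have "u \<otimes> i \<in> (\<otimes>) x ` I" if i: "i \<in> I" for i
  proof -
    have iR: "i \<in> carrier R" using i by auto
    have "u \<otimes> i \<ominus> a \<otimes> (v \<otimes> i) \<in> (\<otimes>) x ` I"
      using mem[OF \<mm>_closed(3) i] uv vR iR ab by simp
    moreover have "a \<otimes> (v \<otimes> i) \<in> (\<otimes>) x ` I"
      using i I_sub by (intro ideal.I_l_closed[OF xI_ideal _ ab(1)] m(2)) blast
    ultimately have "(u \<otimes> i \<ominus> a \<otimes> (v \<otimes> i)) \<oplus> a \<otimes> (v \<otimes> i) \<in> (\<otimes>) x ` I"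
      by (rule ideal_add_closed[OF xI_ideal])
    moreover have "(u \<otimes> i \<ominus> a \<otimes> (v \<otimes> i)) \<oplus> a \<otimes> (v \<otimes> i) = u \<otimes> i"
      using uv(1) vR iR ab(1) by algebra
    ultimately show ?thesis by simp
  qed
  then show "p \<in> A \<times> B" unfolding puv A_def B_def using uv vR m by simp
next
  fix p assume "p \<in> A \<times> B"
  then obtain u v where puv: "p = (u, v)" and u: "u \<in> A" and v: "v \<in> B" by auto
  have uv: "u \<in> carrier R" "v \<in> I" "v \<in> carrier R" using u v B_sub by (auto simp: A_def)
  have "(u, v) \<otimes>\<^bsub>S\<^esub> (m, i) \<in> (\<otimes>) x ` carrier R \<times> (\<otimes>) x ` I" if mi: "m \<in> \<mm>" "i \<in> I" for m i
  proof -
    have c: "m \<in> carrier R" "i \<in> carrier R" "i \<in> \<mm>" using mi I_sub by auto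
    have vi: "v \<otimes> i \<in> (\<otimes>) x ` I" using v c by (simp add: B_def)
    have "u \<otimes> m \<ominus> b \<otimes> (v \<otimes> i) \<in> (\<otimes>) x ` carrier R"
    proof (rule ideal_diff_closed[OF xR_ideal])
      show "u \<otimes> m \<in> (\<otimes>) x ` carrier R" using u mi(1) by (simp add: A_def)
      show "b \<otimes> (v \<otimes> i) \<in> (\<otimes>) x ` carrier R"
        by (rule ideal.I_l_closed[OF xR_ideal subsetD[OF xI_sub_xR vi] ab(2)])
    qed
    moreover have "u \<otimes> i \<oplus> v \<otimes> m \<ominus> a \<otimes> (v \<otimes> i) \<in> (\<otimes>) x ` I"
    proof (intro ideal_diff_closed[OF xI_ideal] ideal_add_closed[OF xI_ideal])
      show "u \<otimes> i \<in> (\<otimes>) x ` I" using u mi(2) by (simp add: A_def)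
      show "v \<otimes> m \<in> (\<otimes>) x ` I" using v mi(1) by (simp add: B_def)
      show "a \<otimes> (v \<otimes> i) \<in> (\<otimes>) x ` I" by (rule ideal.I_l_closed[OF xI_ideal vi ab(1)])
    qed
    ultimately show ?thesis by simp
  qed
  then show "p \<in> {u \<in> carrier S. \<forall>m\<in>\<mm> \<times> I. u \<otimes>\<^bsub>S\<^esub> m \<in> (\<otimes>\<^bsub>S\<^esub>) (x, \<zero>) ` carrier S}"
    unfolding principal_eq puv using uv(1,2) by (simp del: quad_sub_simps(5))
qed

lemma cm_type_quad_sub:
  "cm_type S = height {L. ideal L S \<and> (\<otimes>) x ` carrier R \<times> (\<otimes>) x ` I \<subseteq> L \<and> L \<subseteq> A \<times> B}"
proof -
  have "\<one>\<^bsub>S\<^esub> \<notin> \<mm> \<times> I" using \<mm>.one_imp_carrier \<mm>.I_notcarr by auto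
  moreover have "(x, \<zero>) \<in> \<mm> \<times> I" using xI I_sub I_closed by auto
  ultimately show ?thesis
    using S.cm_type_eq_height[OF ideal_quad_sub_maximal _ quad_sub_units _ quad_sub_regular]
    unfolding colon_eq unfolding principal_eq by blast
qed

lemma A_ideal: "ideal A R" and xR_sub_A: "(\<otimes>) x ` carrier R \<subseteq> A"
proof -
  have sub: "\<mm> \<subseteq> carrier R" "I \<subseteq> carrier R" by auto
  have "A = {u \<in> carrier R. \<forall>m\<in>\<mm>. u \<otimes> m \<in> (\<otimes>) x ` carrier R}
      \<inter> {u \<in> carrier R. \<forall>i\<in>I. u \<otimes> i \<in> (\<otimes>) x ` I}"
    unfolding A_def by blast
  then show "ideal A R"
    using i_intersect[OF ideal_quotient[OF xR_ideal sub(1)] ideal_quotient[OF xI_ideal sub(2)]] by simp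
  have "x \<otimes> r \<otimes> m = x \<otimes> (r \<otimes> m)" if "r \<in> carrier R" "m \<in> carrier R" for r m
    using that x_carrier by (simp add: m_assoc)
  then show "(\<otimes>) x ` carrier R \<subseteq> A"
    using x_carrier sub I.I_l_closed by (auto simp: A_def)
qed

lemma B_ideal: "ideal B R" and xI_sub_B: "(\<otimes>) x ` I \<subseteq> B"
proof -
  have "\<mm> \<subseteq> carrier R" by auto
  then show "ideal B R" unfolding B_def by (rule ideal_quotient[OF xI_ideal])
  have "x \<otimes> i \<otimes> m = x \<otimes> (i \<otimes> m)" if "i \<in> I" "m \<in> \<mm>" for i m
    using that x_carrier by (intro m_assoc) auto
  then show "(\<otimes>) x ` I \<subseteq> B"
    using x_carrier I.I_r_closed by (auto simp: B_def)
qed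

text \<open>
  Additivity of length along \<open>A/xR \<rightarrow> (A \<times> B)/(xR \<times> xI) \<rightarrow> B/xI\<close>. Products \<open>U \<times> V\<close> are ideals of the
  quadratic subring although \<open>t\<close> mixes the coordinates: \<open>I\<close> multiplies \<open>A\<close> and \<open>B\<close> into \<open>xI\<close>,
  which lies in every \<open>U\<close> and every \<open>V\<close>.
\<close>
lemma height_split:
  "height {L. ideal L S \<and> (\<otimes>) x ` carrier R \<times> (\<otimes>) x ` I \<subseteq> L \<and> L \<subseteq> A \<times> B}
    = height {U. ideal U R \<and> (\<otimes>) x ` carrier R \<subseteq> U \<and> U \<subseteq> A}
      + height {V. ideal V R \<and> (\<otimes>) x ` I \<subseteq> V \<and> V \<subseteq> B}"
    (is "height ?F = height ?G + height ?H")
proof (rule height_eq_add[where \<pi> = "\<lambda>L. {p \<in> carrier R. (p, \<zero>) \<in> L}"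
      and \<rho> = "\<lambda>L. {q. \<exists>p. (p, q) \<in> L}" and \<sigma> = "\<lambda>U V. U \<times> V"])
  have AR: "A \<subseteq> carrier R" and BR: "B \<subseteq> carrier R" by (auto simp: A_def B_def)
  show "?G \<noteq> {}" using A_ideal xR_sub_A by blast
  show "?H \<noteq> {}" using B_ideal xI_sub_B by blast
  show "{p \<in> carrier R. (p, \<zero>) \<in> L} \<subseteq> {p \<in> carrier R. (p, \<zero>) \<in> L'}" if "L \<subseteq> L'" for L L'
    using that by blast
  show "{q. \<exists>p. (p, q) \<in> L} \<subseteq> {q. \<exists>p. (p, q) \<in> L'}" if "L \<subseteq> L'" for L L'
    using that by blast
  {
    fix L assume "L \<in> ?F"
    then have L: "ideal L S" and low: "(\<otimes>) x ` carrier R \<times> (\<otimes>) x ` I \<subseteq> L" and up: "L \<subseteq> A \<times> B"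
      by simp_all
    have add: "(p \<oplus> p', q \<oplus> q') \<in> L" if "(p, q) \<in> L" "(p', q') \<in> L" for p q p' q'
      using S.ideal_add_closed[OF L that] by simp
    have smult: "(r \<otimes> p, r \<otimes> q) \<in> L" if r: "r \<in> carrier R" and pq: "(p, q) \<in> L" for r p q
    proof -
      have "p \<in> carrier R" "q \<in> carrier R" using pq up AR BR by auto
      moreover have "(r, \<zero>) \<in> carrier S" using r I_closed by simp
      ultimately show ?thesis using ideal.I_l_closed[OF L pq] scalar_mult[OF r] by metis
    qed
    have zero: "(\<zero>, \<zero>) \<in> L" using S.ideal_zero_mem[OF L] by simp
    have "ideal {p \<in> carrier R. (p, \<zero>) \<in> L} R"
    proof (rule ideal_of_closed)
      show "p \<oplus> p' \<in> {p \<in> carrier R. (p, \<zero>) \<in> L}"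
        if "p \<in> {p \<in> carrier R. (p, \<zero>) \<in> L}" "p' \<in> {p \<in> carrier R. (p, \<zero>) \<in> L}" for p p'
        using that add[of p \<zero> p' \<zero>] by simp
      show "r \<otimes> p \<in> {p \<in> carrier R. (p, \<zero>) \<in> L}"
        if "r \<in> carrier R" "p \<in> {p \<in> carrier R. (p, \<zero>) \<in> L}" for r p
        using that smult[of r p \<zero>] by simp
    qed (use zero in auto)
    moreover have "(\<otimes>) x ` carrier R \<subseteq> {p \<in> carrier R. (p, \<zero>) \<in> L}"
      using low ideal_zero_mem[OF xI_ideal] ideal.Icarr[OF xR_ideal] by blast
    ultimately show "{p \<in> carrier R. (p, \<zero>) \<in> L} \<in> ?G" using up by blast
    have "ideal {q. \<exists>p. (p, q) \<in> L} R"
    proof (rule ideal_of_closed)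
      show "{q. \<exists>p. (p, q) \<in> L} \<subseteq> carrier R" using up BR by blast
      show "\<zero> \<in> {q. \<exists>p. (p, q) \<in> L}" using zero by blast
      show "q \<oplus> q' \<in> {q. \<exists>p. (p, q) \<in> L}"
        if "q \<in> {q. \<exists>p. (p, q) \<in> L}" "q' \<in> {q. \<exists>p. (p, q) \<in> L}" for q q'
        using that add by blast
      show "r \<otimes> q \<in> {q. \<exists>p. (p, q) \<in> L}" if "r \<in> carrier R" "q \<in> {q. \<exists>p. (p, q) \<in> L}" for r q
        using that smult by blast
    qed
    moreover have "(\<otimes>) x ` I \<subseteq> {q. \<exists>p. (p, q) \<in> L}"
      using low ideal_zero_mem[OF xR_ideal] by blast
    ultimately show "{q. \<exists>p. (p, q) \<in> L} \<in> ?H" using up by blast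
  }
  {
    fix L L' assume "L \<in> ?F" "L' \<in> ?F" and sub: "L \<subseteq> L'"
      and eq: "{p \<in> carrier R. (p, \<zero>) \<in> L} = {p \<in> carrier R. (p, \<zero>) \<in> L'}"
        "{q. \<exists>p. (p, q) \<in> L} = {q. \<exists>p. (p, q) \<in> L'}"
    then have L: "ideal L S" "L \<subseteq> A \<times> B" and L': "ideal L' S" "L' \<subseteq> A \<times> B" by simp_all
    have "(p, q) \<in> L" if pq: "(p, q) \<in> L'" for p q
    proof -
      obtain p' where p': "(p', q) \<in> L" using pq eq(2) by blast
      \<comment> \<open>\<open>(p, q)\<close> and \<open>(p', q)\<close> differ by \<open>(p - p', 0)\<close>, which \<open>L\<close> contains by the first trace\<close>
      have c: "p \<in> carrier R" "q \<in> carrier R" "p' \<in> carrier R"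
        using pq p' L L' AR BR by auto
      have "(\<ominus> \<one>, \<zero>) \<in> carrier S" using I_closed by simp
      then have "(\<ominus> \<one>, \<zero>) \<otimes>\<^bsub>S\<^esub> (p', q) \<in> L'"
        using p' sub by (intro ideal.I_l_closed[OF L'(1)]) auto
      then have "(\<ominus> p', \<ominus> q) \<in> L'" using c by (subst (asm) scalar_mult) (simp_all add: l_minus)
      then have "(p, q) \<oplus>\<^bsub>S\<^esub> (\<ominus> p', \<ominus> q) \<in> L'" by (rule S.ideal_add_closed[OF L'(1) pq])
      then have "(p \<ominus> p', \<zero>) \<in> L'" using c by (simp add: r_neg minus_eq)
      then have "(p \<ominus> p', \<zero>) \<in> L" using eq(1) c by blast
      then have "(p \<ominus> p', \<zero>) \<oplus>\<^bsub>S\<^esub> (p', q) \<in> L" using p' by (rule S.ideal_add_closed[OF L(1)])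
      then show ?thesis using c by (simp add: minus_eq a_assoc l_neg)
    qed
    then show "L = L'" using sub by auto
  }
  fix U V assume "U \<in> ?G" "V \<in> ?H"
  then have U: "ideal U R" "(\<otimes>) x ` carrier R \<subseteq> U" "U \<subseteq> A"
    and V: "ideal V R" "(\<otimes>) x ` I \<subseteq> V" "V \<subseteq> B" by simp_all
  have "ideal (U \<times> V) S"
  proof (rule S.ideal_of_closed)
    show "U \<times> V \<subseteq> carrier S" using U V A_def B_sub by auto
    show "\<zero>\<^bsub>S\<^esub> \<in> U \<times> V" using ideal_zero_mem[OF U(1)] ideal_zero_mem[OF V(1)] by simp
    show "u \<oplus>\<^bsub>S\<^esub> v \<in> U \<times> V" if "u \<in> U \<times> V" "v \<in> U \<times> V" for u v
      using that ideal_add_closed[OF U(1)] ideal_add_closed[OF V(1)] by auto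
    show "r \<otimes>\<^bsub>S\<^esub> u \<in> U \<times> V" if r: "r \<in> carrier S" and u: "u \<in> U \<times> V" for r u
    proof -
      obtain s i p q where [simp]: "r = (s, i)" "u = (p, q)"
        and c: "s \<in> carrier R" "i \<in> I" "p \<in> U" "q \<in> V" using r u by auto
      have R: "i \<in> carrier R" "p \<in> carrier R" "q \<in> carrier R" "i \<in> \<mm>"
        using c U V AR BR I_sub by auto
      have "q \<otimes> i \<in> (\<otimes>) x ` I" "p \<otimes> i \<in> (\<otimes>) x ` I"
        using c R U(3) V(3) by (auto simp: A_def B_def)
      then have qi: "i \<otimes> q \<in> (\<otimes>) x ` I" and pi: "i \<otimes> p \<in> (\<otimes>) x ` I"
        using R by (simp_all add: m_comm)
      have "s \<otimes> p \<ominus> b \<otimes> (i \<otimes> q) \<in> U"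
      proof (rule ideal_diff_closed[OF U(1)])
        show "s \<otimes> p \<in> U" by (rule ideal.I_l_closed[OF U(1) c(3) c(1)])
        show "b \<otimes> (i \<otimes> q) \<in> U"
          by (rule ideal.I_l_closed[OF U(1) subsetD[OF U(2) subsetD[OF xI_sub_xR qi]] ab(2)])
      qed
      moreover have "s \<otimes> q \<oplus> i \<otimes> p \<ominus> a \<otimes> (i \<otimes> q) \<in> V"
      proof (intro ideal_diff_closed[OF V(1)] ideal_add_closed[OF V(1)])
        show "s \<otimes> q \<in> V" by (rule ideal.I_l_closed[OF V(1) c(4) c(1)])
        show "i \<otimes> p \<in> V" by (rule subsetD[OF V(2) pi])
        show "a \<otimes> (i \<otimes> q) \<in> V" by (rule ideal.I_l_closed[OF V(1) subsetD[OF V(2) qi] ab(1)])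
      qed
      ultimately show ?thesis by simp
    qed
  qed
  then show "U \<times> V \<in> ?F" using U V by (simp add: Sigma_mono)
  have ne: "U \<noteq> {}" "V \<noteq> {}" using ideal_zero_mem[OF U(1)] ideal_zero_mem[OF V(1)] by blast+
  show "U \<times> V \<subset> U' \<times> V" if "U \<subset> U'" for U' using that ne(2) by blast
  show "U \<times> V \<subset> U \<times> V'" if "V \<subset> V'" for V' using that ne(1) by blast
qed

lemma frac_length_endo_colon:
  "frac_length R (colon R (frac_embed R ` I) (frac_embed R ` I)
      \<inter> colon R (frac_embed R ` carrier R) (frac_embed R ` \<mm>)) (frac_embed R ` carrier R)
    = height {U. ideal U R \<and> (\<otimes>) x ` carrier R \<subseteq> U \<and> U \<subseteq> A}"
proof -
  have sub: "I \<subseteq> carrier R" "\<mm> \<subseteq> carrier R" by (simp_all add: subsetI)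
  have xm: "x \<in> \<mm>" using xI I_sub by (rule subsetD[rotated])
  have "inj_on (\<lambda>u. fraction R u x) (carrier R)"
    by (rule inj_onI) (use fraction_inject[OF _ _ xreg] in simp)
  then have "(\<lambda>u. fraction R u x) ` {u \<in> carrier R. \<forall>k\<in>I. u \<otimes> k \<in> (\<otimes>) x ` I}
      \<inter> (\<lambda>u. fraction R u x) ` {u \<in> carrier R. \<forall>k\<in>\<mm>. u \<otimes> k \<in> (\<otimes>) x ` carrier R}
    = (\<lambda>u. fraction R u x) ` ({u \<in> carrier R. \<forall>k\<in>I. u \<otimes> k \<in> (\<otimes>) x ` I}
      \<inter> {u \<in> carrier R. \<forall>k\<in>\<mm>. u \<otimes> k \<in> (\<otimes>) x ` carrier R})"
    by (rule inj_on_image_Int[symmetric]) auto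
  also have "{u \<in> carrier R. \<forall>k\<in>I. u \<otimes> k \<in> (\<otimes>) x ` I}
      \<inter> {u \<in> carrier R. \<forall>k\<in>\<mm>. u \<otimes> k \<in> (\<otimes>) x ` carrier R} = A"
    unfolding A_def by blast
  finally have inter: "(\<lambda>u. fraction R u x) ` {u \<in> carrier R. \<forall>k\<in>I. u \<otimes> k \<in> (\<otimes>) x ` I}
      \<inter> (\<lambda>u. fraction R u x) ` {u \<in> carrier R. \<forall>k\<in>\<mm>. u \<otimes> k \<in> (\<otimes>) x ` carrier R}
    = (\<lambda>u. fraction R u x) ` A" .
  show ?thesis
    unfolding colon_eq_fractions[OF sub(1,1) xI xreg] colon_eq_fractions[OF subset_refl sub(2) xm xreg]
    unfolding frac_embed_image_eq_fractions[OF subset_refl xreg]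
    unfolding inter by (rule frac_length_eq_height_ideals[OF xR_ideal A_ideal xR_sub_A xreg])
qed

lemma cm_type_quad_sub_eq:
  "cm_type S = frac_length R (colon R (frac_embed R ` I) (frac_embed R ` I)
      \<inter> colon R (frac_embed R ` carrier R) (frac_embed R ` \<mm>)) (frac_embed R ` carrier R)
    + frac_length R (colon R (frac_embed R ` I) (frac_embed R ` \<mm>)) (frac_embed R ` I)"
proof -
  have "frac_length R (colon R (frac_embed R ` I) (frac_embed R ` \<mm>)) (frac_embed R ` I)
      = height {V. ideal V R \<and> (\<otimes>) x ` I \<subseteq> V \<and> V \<subseteq> B}"
    unfolding B_def
  proof (rule frac_length_colon[OF I.is_ideal _ _ xreg])
    show "\<mm> \<subseteq> carrier R" by (simp add: subsetI)
    show "x \<in> \<mm>" using I_sub xI by (rule subsetD)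
    show "j \<otimes> k \<in> I" if "j \<in> I" "k \<in> \<mm>" for j k using that by (simp add: I.I_r_closed)
  qed
  then show ?thesis
    unfolding frac_length_endo_colon by (simp only: cm_type_quad_sub height_split)
qed

end

section \<open>The Rees algebra modulo the quadratic polynomial\<close>

context cring
begin

lemma one_ideals_set [simp]: "\<one>\<^bsub>ideals_set R\<^esub> = carrier R"
  by (simp add: ideals_set_def)

lemma
  assumes I: "ideal I R"
  shows ideal_power: "ideal (I [^]\<^bsub>ideals_set R\<^esub> n) R"
    and ideal_power_1: "I [^]\<^bsub>ideals_set R\<^esub> (1::nat) = I"
    and ideal_power_Suc_sub: "I [^]\<^bsub>ideals_set R\<^esub> Suc n \<subseteq> I"
    and ideal_power_mult: "u \<in> I [^]\<^bsub>ideals_set R\<^esub> m \<Longrightarrow> v \<in> I [^]\<^bsub>ideals_set R\<^esub> n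
      \<Longrightarrow> u \<otimes> v \<in> I [^]\<^bsub>ideals_set R\<^esub> (m + n)"
proof -
  interpret J: comm_monoid "ideals_set R" by (rule ideals_set_is_comm_monoid)
  have c: "I \<in> carrier (ideals_set R)" using I by (simp add: ideals_set_def)
  show p: "ideal (I [^]\<^bsub>ideals_set R\<^esub> n) R" for n :: nat
    using J.nat_pow_closed[OF c, of n] by (simp add: ideals_set_def)
  show "I [^]\<^bsub>ideals_set R\<^esub> (1::nat) = I"
    by (rule J.nat_pow_eone[OF c])
  show "I [^]\<^bsub>ideals_set R\<^esub> Suc n \<subseteq> I"
    using J.nat_pow_Suc[of I n] ideal_prod_inter[OF p[of n] I] by (simp add: ideals_set_def)
  show "u \<otimes> v \<in> I [^]\<^bsub>ideals_set R\<^esub> (m + n)"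
    if "u \<in> I [^]\<^bsub>ideals_set R\<^esub> m" "v \<in> I [^]\<^bsub>ideals_set R\<^esub> n"
  proof -
    have "u \<otimes> v \<in> (I [^]\<^bsub>ideals_set R\<^esub> m) \<cdot> (I [^]\<^bsub>ideals_set R\<^esub> n)"
      using that by (rule ideal_prod.prod)
    also have "\<dots> = I [^]\<^bsub>ideals_set R\<^esub> (m + n)"
      using J.nat_pow_mult[OF c, of m n] by (simp add: ideals_set_def)
    finally show ?thesis .
  qed
qed

lemma finsum_in_additive_subgroup:
  assumes H: "additive_subgroup H R" and f: "\<And>i. i \<in> A \<Longrightarrow> f i \<in> H"
  shows "finsum R f A \<in> H"
  using f
proof (induction A rule: infinite_finite_induct)
  case (insert i A)
  have sub: "H \<subseteq> carrier R" using additive_subgroup.a_subset[OF H] .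
  then have "finsum R f (insert i A) = f i \<oplus> finsum R f A"
    using insert by (intro finsum_insert) auto
  then show ?case using insert by (simp add: additive_subgroup.a_closed[OF H])
qed (simp_all add: additive_subgroup.zero_closed[OF H])

lemma rees_subring:
  assumes I: "ideal I R"
  shows "subring (carrier (rees_algebra R I)) (UP R)"
proof -
  interpret UP: UP_cring R "UP R" by unfold_locales simp_all
  note pw = ideal_power[OF I]
  show ?thesis
  proof (rule UP.P.subringI)
    show "carrier (rees_algebra R I) \<subseteq> carrier (UP R)" by (auto simp: rees_algebra_def)
    have "\<one> \<in> I [^]\<^bsub>ideals_set R\<^esub> (0::nat)" by simp
    then show "\<one>\<^bsub>UP R\<^esub> \<in> carrier (rees_algebra R I)"
      using ideal_zero_mem[OF pw] by (simp add: rees_algebra_def)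
  next
    fix p assume "p \<in> carrier (rees_algebra R I)"
    then show "\<ominus>\<^bsub>UP R\<^esub> p \<in> carrier (rees_algebra R I)"
      using ideal_neg_closed[OF pw] by (simp add: rees_algebra_def)
  next
    fix p q assume pq: "p \<in> carrier (rees_algebra R I)" "q \<in> carrier (rees_algebra R I)"
    then show "p \<oplus>\<^bsub>UP R\<^esub> q \<in> carrier (rees_algebra R I)"
      using ideal_add_closed[OF pw] by (simp add: rees_algebra_def)
    have "(\<Oplus>i\<in>{..n}. coeff (UP R) p i \<otimes> coeff (UP R) q (n - i)) \<in> I [^]\<^bsub>ideals_set R\<^esub> n" for n
    proof (rule finsum_in_additive_subgroup[OF ideal.axioms(1)[OF pw]])
      fix i assume "i \<in> {..n}"
      then have "i + (n - i) = n" by simp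
      then show "coeff (UP R) p i \<otimes> coeff (UP R) q (n - i) \<in> I [^]\<^bsub>ideals_set R\<^esub> n"
        using ideal_power_mult[OF I, of _ i _ "n - i"] pq by (simp add: rees_algebra_def)
    qed
    then show "p \<otimes>\<^bsub>UP R\<^esub> q \<in> carrier (rees_algebra R I)"
      using pq by (simp add: rees_algebra_def)
  qed
qed

text \<open>
  Evaluation at \<open>t\<close> maps \<open>R[t]\<close> to the quadratic extension with kernel the principal ideal of
  \<open>t\<^sup>2 + at + b\<close>, by division by this monic polynomial. Its restriction to the Rees algebra has image
  \<open>R + I t\<close>: every coefficient in positive degree lies in \<open>I\<close>, and \<open>I t\<close> is hit by linear terms.
\<close>
lemma rees_quotient_iso:
  assumes I: "ideal I R" and ab: "a \<in> carrier R" "b \<in> carrier R" and nontriv: "\<one> \<noteq> \<zero>"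
  shows "cring (rees_quotient R I a b)" and "\<exists>g. g \<in> ring_iso (quad_sub R I a b) (rees_quotient R I a b)"
proof -
  let ?P = "UP R" and ?T = "quad_ext R a b" and ?t = "(\<zero>, \<one>)"
  let ?Rees = "rees_algebra R I" and ?f = "quad_poly R a b"
  define h :: "'a \<Rightarrow> 'a \<times> 'a" where "h = (\<lambda>r. (r, \<zero>))"
  define \<phi> where "\<phi> = eval R ?T h ?t"
  interpret T: cring ?T using quad_ext_cring[OF ab] .
  have h: "h \<in> ring_hom R ?T"
    unfolding h_def using ab by (intro ring_hom_memI) (auto simp: minus_eq)
  interpret U: UP_pre_univ_prop R ?T h ?P
    by (rule UP_pre_univ_propI[OF is_cring T.is_cring h])
  have t: "?t \<in> carrier ?T" by simp
  have \<phi>_hom: "\<phi> \<in> ring_hom ?P ?T" unfolding \<phi>_def by (rule U.eval_ring_hom[OF t])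
  have \<phi>_monom: "\<phi> (monom ?P r n) = (r, \<zero>) \<otimes>\<^bsub>?T\<^esub> ?t [^]\<^bsub>?T\<^esub> n" if "r \<in> carrier R" for r n
    using U.eval_monom[OF that t, of n] unfolding \<phi>_def h_def .
  have \<phi>_monom0: "\<phi> (monom ?P r 0) = (r, \<zero>)" if "r \<in> carrier R" for r
    unfolding \<phi>_monom[OF that] T.nat_pow_0 using that ab by (simp add: minus_eq)
  have \<phi>_monom1: "\<phi> (monom ?P r 1) = (\<zero>, r)" if "r \<in> carrier R" for r
    unfolding \<phi>_monom[OF that] T.nat_pow_eone[OF t] using that ab by (simp add: minus_eq)
  have "?t [^]\<^bsub>?T\<^esub> (2::nat) = ?t \<otimes>\<^bsub>?T\<^esub> ?t"
    using T.nat_pow_Suc[of ?t 1] unfolding T.nat_pow_eone[OF t] Suc_1 .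
  then have \<phi>_monom2: "\<phi> (monom ?P \<one> 2) = (\<ominus> b, \<ominus> a)"
    unfolding \<phi>_monom[OF one_closed] using ab by (simp add: minus_eq)
  have f: "?f \<in> carrier ?P" using ab by (simp add: quad_poly_def)
  have f_coeff: "coeff ?P ?f n = (if n = 2 then \<one> else if n = 1 then a else if n = 0 then b else \<zero>)" for n
    using ab by (simp add: quad_poly_def)
  have "\<phi> ?f = \<phi> (monom ?P \<one> 2) \<oplus>\<^bsub>?T\<^esub> \<phi> (monom ?P a 1) \<oplus>\<^bsub>?T\<^esub> \<phi> (monom ?P b 0)"
    unfolding quad_poly_def using ab by (simp add: ring_hom_add[OF \<phi>_hom])
  also have "\<dots> = \<zero>\<^bsub>?T\<^esub>"
    using ab by (simp add: \<phi>_monom0 \<phi>_monom1 \<phi>_monom2 l_neg del: One_nat_def)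
  finally have \<phi>_f: "\<phi> ?f = \<zero>\<^bsub>?T\<^esub>" .
  have f_deg: "deg R ?f = 2"
  proof (rule antisym)
    show "deg R ?f \<le> 2" by (rule U.deg_aboveI[OF _ f]) (simp add: f_coeff)
    show "2 \<le> deg R ?f" by (rule U.deg_belowI[OF _ f]) (simp add: f_coeff nontriv)
  qed
  have ker: "p \<in> PIdl\<^bsub>?P\<^esub> ?f \<longleftrightarrow> \<phi> p = \<zero>\<^bsub>?T\<^esub>" if p: "p \<in> carrier ?P" for p
  proof
    assume "p \<in> PIdl\<^bsub>?P\<^esub> ?f"
    then obtain q where q: "q \<in> carrier ?P" "p = q \<otimes>\<^bsub>?P\<^esub> ?f" unfolding cgenideal_def by blast
    then have "\<phi> p = \<phi> q \<otimes>\<^bsub>?T\<^esub> \<zero>\<^bsub>?T\<^esub>" using ring_hom_mult[OF \<phi>_hom] f \<phi>_f by simp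
    also have "\<dots> = \<zero>\<^bsub>?T\<^esub>" by (rule T.r_null[OF ring_hom_closed[OF \<phi>_hom q(1)]])
    finally show "\<phi> p = \<zero>\<^bsub>?T\<^esub>" .
  next
    assume 0: "\<phi> p = \<zero>\<^bsub>?T\<^esub>"
    have "?f \<noteq> \<zero>\<^bsub>?P\<^esub>" using f_deg U.deg_zero by (metis zero_neq_numeral)
    from U.long_div_theorem[OF f p this] obtain q r and k :: nat
      where q: "q \<in> carrier ?P" and r: "r \<in> carrier ?P"
        and div: "coeff ?P ?f (deg R ?f) [^] k \<odot>\<^bsub>?P\<^esub> p = ?f \<otimes>\<^bsub>?P\<^esub> q \<oplus>\<^bsub>?P\<^esub> r"
        and small: "r = \<zero>\<^bsub>?P\<^esub> \<or> deg R r < deg R ?f" by blast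
    have p_eq: "p = ?f \<otimes>\<^bsub>?P\<^esub> q \<oplus>\<^bsub>?P\<^esub> r" using div p by (simp add: f_deg f_coeff)
    \<comment> \<open>the remainder is \<open>r\<^sub>0 + r\<^sub>1 t\<close>, and its value \<open>(r\<^sub>0, r\<^sub>1)\<close> vanishes only if it is zero itself\<close>
    have high: "coeff ?P r n = \<zero>" if "n \<ge> 2" for n
      using small that r U.deg_aboveD[OF _ r, of n] by (auto simp: f_deg)
    have r_eq: "r = monom ?P (coeff ?P r 0) 0 \<oplus>\<^bsub>?P\<^esub> monom ?P (coeff ?P r 1) 1"
    proof (rule U.up_eqI)
      fix n :: nat
      consider "n = (0::nat)" | "n = 1" | "n \<ge> 2" by linarith
      then show "coeff ?P r n = coeff ?P (monom ?P (coeff ?P r 0) 0 \<oplus>\<^bsub>?P\<^esub> monom ?P (coeff ?P r 1) 1) n"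
        using r high by cases simp_all
    qed (use r in simp_all)
    have "\<zero>\<^bsub>?T\<^esub> = \<phi> ?f \<otimes>\<^bsub>?T\<^esub> \<phi> q \<oplus>\<^bsub>?T\<^esub> \<phi> r"
      using 0 p_eq f q r by (simp add: ring_hom_add[OF \<phi>_hom] ring_hom_mult[OF \<phi>_hom])
    also have "\<dots> = \<phi> r"
      using ring_hom_closed[OF \<phi>_hom q] ring_hom_closed[OF \<phi>_hom r] by (simp add: \<phi>_f del: quad_ext_simps)
    also have "\<dots> = \<phi> (monom ?P (coeff ?P r 0) 0) \<oplus>\<^bsub>?T\<^esub> \<phi> (monom ?P (coeff ?P r 1) 1)"
      using ring_hom_add[OF \<phi>_hom, of "monom ?P (coeff ?P r 0) 0" "monom ?P (coeff ?P r 1) 1"] r r_eq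
      by (simp del: One_nat_def)
    also have "\<dots> = (coeff ?P r 0, coeff ?P r 1)"
      using r by (simp add: \<phi>_monom0 \<phi>_monom1 del: One_nat_def)
    finally have "coeff ?P r 0 = \<zero>" "coeff ?P r 1 = \<zero>" by auto
    then have "r = \<zero>\<^bsub>?P\<^esub>" using r_eq by (metis U.P.l_zero U.UP_zero_closed U.monom_zero)
    then have "p = q \<otimes>\<^bsub>?P\<^esub> ?f" using p_eq f q by (simp add: U.P.m_comm)
    then show "p \<in> PIdl\<^bsub>?P\<^esub> ?f" using q unfolding cgenideal_def by blast
  qed
  have sub: "carrier ?Rees \<subseteq> carrier ?P" by (auto simp: rees_algebra_def)
  have Rees: "?Rees = ?P\<lparr>carrier := carrier ?Rees\<rparr>" by (simp add: rees_algebra_def)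
  interpret Rees: cring ?Rees
    using U.P.subcringI'[OF rees_subring[OF I]] U.P.subcring_iff[OF sub] Rees by simp
  have "\<phi> \<in> ring_hom ?Rees ?T"
  proof (rule ring_hom_memI)
    fix p q assume "p \<in> carrier ?Rees" "q \<in> carrier ?Rees"
    then have pq: "p \<in> carrier ?P" "q \<in> carrier ?P" using sub by blast+
    show "\<phi> p \<in> carrier ?T" using ring_hom_closed[OF \<phi>_hom pq(1)] .
    show "\<phi> (p \<otimes>\<^bsub>?Rees\<^esub> q) = \<phi> p \<otimes>\<^bsub>?T\<^esub> \<phi> q"
      using ring_hom_mult[OF \<phi>_hom pq] by (subst Rees) simp
    show "\<phi> (p \<oplus>\<^bsub>?Rees\<^esub> q) = \<phi> p \<oplus>\<^bsub>?T\<^esub> \<phi> q"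
      using ring_hom_add[OF \<phi>_hom pq] by (subst Rees) simp
  next
    show "\<phi> \<one>\<^bsub>?Rees\<^esub> = \<one>\<^bsub>?T\<^esub>"
      using ring_hom_one[OF \<phi>_hom] by (subst Rees) simp
  qed
  then interpret \<phi>: ring_hom_ring ?Rees ?T \<phi>
    by (rule ring_hom_ringI2[OF Rees.ring_axioms T.ring_axioms])
  have kernel: "a_kernel ?Rees ?T \<phi> = (PIdl\<^bsub>?P\<^esub> ?f) \<inter> carrier ?Rees"
  proof (rule Set.set_eqI)
    fix p
    show "p \<in> a_kernel ?Rees ?T \<phi> \<longleftrightarrow> p \<in> (PIdl\<^bsub>?P\<^esub> ?f) \<inter> carrier ?Rees"
      using ker[of p] sub unfolding a_kernel_def' by blast
  qed
  have image: "\<phi> ` carrier ?Rees = carrier R \<times> I"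
  proof (intro equalityI subsetI)
    fix y assume "y \<in> \<phi> ` carrier ?Rees"
    then obtain p where p: "p \<in> carrier ?P" "\<And>n. coeff ?P p n \<in> I [^]\<^bsub>ideals_set R\<^esub> n" "y = \<phi> p"
      by (auto simp: rees_algebra_def)
    have y: "y = (\<Oplus>\<^bsub>?T\<^esub>i\<in>{..deg R p}. (coeff ?P p i, \<zero>) \<otimes>\<^bsub>?T\<^esub> (?t [^]\<^bsub>?T\<^esub> i))"
      unfolding p(3) \<phi>_def h_def by (rule U.eval_on_carrier[OF p(1)])
    show "y \<in> carrier R \<times> I"
      unfolding y
    proof (rule T.finsum_in_additive_subgroup)
      show "additive_subgroup (carrier R \<times> I) ?T"
        using subring.axioms(1)[OF quad_sub_cring(2)[OF I ab]] by (rule additive_subgroup.intro)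
      fix i
      have c: "coeff ?P p i \<in> carrier R" using p by simp
      show "(coeff ?P p i, \<zero>) \<otimes>\<^bsub>?T\<^esub> (?t [^]\<^bsub>?T\<^esub> i) \<in> carrier R \<times> I"
      proof (cases i)
        case 0
        then show ?thesis using c ab ideal_zero_mem[OF I] by (simp add: minus_eq)
      next
        case (Suc n)
        then have cI: "coeff ?P p i \<in> I" using p(2)[of i] ideal_power_Suc_sub[OF I] by blast
        obtain u v where uv: "?t [^]\<^bsub>?T\<^esub> i = (u, v)" "u \<in> carrier R" "v \<in> carrier R"
          using T.nat_pow_closed[OF t, of i] by (cases "?t [^]\<^bsub>?T\<^esub> i") auto
        show ?thesis
          unfolding uv(1) using uv c ab ideal.I_r_closed[OF I cI] by (simp add: minus_eq)
      qed
    qed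
  next
    fix y assume "y \<in> carrier R \<times> I"
    then obtain r i where y: "y = (r, i)" "r \<in> carrier R" "i \<in> I" by auto
    have i: "i \<in> carrier R" using ideal.Icarr[OF I y(3)] .
    let ?p = "monom ?P r 0 \<oplus>\<^bsub>?P\<^esub> monom ?P i 1"
    have "\<phi> ?p = y"
      using y i by (simp add: ring_hom_add[OF \<phi>_hom] \<phi>_monom0 \<phi>_monom1 del: One_nat_def)
    moreover have "coeff ?P ?p n \<in> I [^]\<^bsub>ideals_set R\<^esub> n" for n
    proof -
      consider "n = 0" | "n = 1" | "n \<ge> 2" by linarith
      then show ?thesis
        using y i ideal_zero_mem[OF ideal_power[OF I]] ideal_power_1[OF I]
        by cases simp_all
    qed
    then have "?p \<in> carrier ?Rees" using y i by (simp add: rees_algebra_def)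
    ultimately show "y \<in> \<phi> ` carrier ?Rees" by blast
  qed
  have Q: "rees_quotient R I a b = ?Rees Quot (a_kernel ?Rees ?T \<phi>)"
    by (simp add: rees_quotient_def kernel)
  show "cring (rees_quotient R I a b)"
    unfolding Q by (rule ideal.quotient_is_cring[OF \<phi>.kernel_is_ideal Rees.is_cring])
  have "(\<lambda>X. the_elem (\<phi> ` X)) \<in> ring_iso (rees_quotient R I a b) (quad_sub R I a b)"
    using \<phi>.FactRing_iso_set_aux unfolding Q image quad_sub_def .
  then show "\<exists>g. g \<in> ring_iso (quad_sub R I a b) (rees_quotient R I a b)"
    using ring_iso_set_sym[OF cring.axioms(1)[OF \<open>cring (rees_quotient R I a b)\<close>]] by blast
qed

end

section \<open>Noetherian local rings\<close>

text \<open>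
  Zorn's lemma applies because a nonempty chain of ideals of a Noetherian ring contains its union.
\<close>
lemma (in noetherian_ring) exists_maximalideal_containing:
  assumes J: "ideal J R" "J \<noteq> carrier R"
  obtains M where "maximalideal M R" "J \<subseteq> M"
proof -
  let ?F = "{K. ideal K R \<and> J \<subseteq> K \<and> K \<noteq> carrier R}"
  have "\<exists>M\<in>?F. \<forall>K\<in>?F. M \<subseteq> K \<longrightarrow> K = M"
  proof (rule subset_Zorn)
    fix C assume C: "subset.chain ?F C"
    show "\<exists>U\<in>?F. \<forall>K\<in>C. K \<subseteq> U"
    proof (cases "C = {}")
      case True
      then show ?thesis using J by blast
    next
      case False
      have "subset.chain {K. ideal K R} C"
        using C by (auto simp: pred_on.chain_def)
      then have "\<Union>C \<in> C" using ideal_chain_is_trivial[OF False] by blast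
      then show ?thesis using C by (intro bexI[of _ "\<Union>C"]) (auto simp: pred_on.chain_def)
    qed
  qed
  then obtain M where MF: "M \<in> ?F" and max: "\<forall>K\<in>?F. M \<subseteq> K \<longrightarrow> K = M" by (rule bexE)
  then have M: "ideal M R" "J \<subseteq> M" "M \<noteq> carrier R" by simp_all
  have "maximalideal M R"
  proof (rule maximalidealI[OF M(1)])
    show "carrier R \<noteq> M" using M(3) by simp
    show "K = M \<or> K = carrier R" if "ideal K R" "M \<subseteq> K" "K \<subseteq> carrier R" for K
    proof (cases "K = carrier R")
      case False
      then have "K \<in> ?F" using that M(2) by simp
      then show ?thesis using max \<open>M \<subseteq> K\<close> by blast
    qed simp
  qed
  then show thesis using that M(2) by blast
qed

text \<open>
  In a local ring every proper ideal lies in \<open>\<mm>\<close>, so \<open>I \<subseteq> \<mm>\<close> and all elements outside \<open>\<mm>\<close> are units;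
  a regular element of \<open>I\<close> serves as the common denominator throughout.
\<close>
lemma cm_type_rees_quotient:
  fixes R (structure)
  assumes loc: "local_ring \<mm> R" and noeth: "noetherian_ring R"
    and I: "regular_ideal I R" "I \<noteq> carrier R" and ab: "a \<in> carrier R" "b \<in> carrier R"
  shows "cm_type (rees_quotient R I a b)
    = frac_length R (colon R (frac_embed R ` I) (frac_embed R ` I)
        \<inter> colon R (frac_embed R ` carrier R) (frac_embed R ` \<mm>)) (frac_embed R ` carrier R)
      + frac_length R (colon R (frac_embed R ` I) (frac_embed R ` \<mm>)) (frac_embed R ` I)"
proof -
  interpret local_ring \<mm> R by fact
  interpret N: noetherian_ring R by fact
  have below: "J \<subseteq> \<mm>" if J: "ideal J R" "J \<noteq> carrier R" for J
  proof -
    obtain M where "maximalideal M R" "J \<subseteq> M" by (rule N.exists_maximalideal_containing[OF J])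
    then show ?thesis using maximalideal_unique by blast
  qed
  have units: "carrier R - \<mm> \<subseteq> Units R"
  proof
    fix u assume u: "u \<in> carrier R - \<mm>"
    then have "u \<in> PIdl u" by (simp add: cgenideal_self)
    then have "PIdl u = carrier R" using below[OF cgenideal_ideal] u by blast
    then have "\<one> \<in> PIdl u" by simp
    then obtain v where "v \<in> carrier R" "\<one> = v \<otimes> u" unfolding cgenideal_def by blast
    then show "u \<in> Units R" using u m_comm[of u v] by (auto simp: Units_def)
  qed
  have idealI: "ideal I R" using I(1) by (simp add: regular_ideal_def)
  obtain x where x: "x \<in> I" "x \<in> regular_elems R" using I(1) by (auto simp: regular_ideal_def)
  have max: "maximalideal \<mm> R" by (rule maximalideal_axioms)
  interpret Q: quadratic_local R I \<mm> a b x
    by (intro quadratic_local.intro quadratic_local_axioms.intro is_cring idealI max units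
        below[OF idealI I(2)] ab x)
  have one_notin: "\<one> \<notin> \<mm>" using one_imp_carrier I_notcarr by auto
  then have "\<one> \<noteq> \<zero>" using ideal_zero_mem[OF is_ideal] by auto
  from rees_quotient_iso[OF idealI ab this] obtain g
    where cr: "cring (rees_quotient R I a b)"
      and g: "g \<in> ring_iso (quad_sub R I a b) (rees_quotient R I a b)" by blast
  have "cm_type (rees_quotient R I a b) = cm_type (quad_sub R I a b)"
  proof (rule cm_type_iso[OF Q.S.is_cring cr g Q.ideal_quad_sub_maximal _ Q.quad_sub_units _ Q.quad_sub_regular])
    show "\<one>\<^bsub>quad_sub R I a b\<^esub> \<notin> \<mm> \<times> I" using one_notin by simp
    show "(x, \<zero>) \<in> \<mm> \<times> I" using x(1) below[OF idealI I(2)] ideal_zero_mem[OF idealI] by blast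
  qed
  then show ?thesis by (simp only: Q.cm_type_quad_sub_eq)
qed

theorem theorem3p2:
  fixes R :: "('a, 'm) ring_scheme" and \<mm> I :: "'a set" and a b :: 'a
  assumes "local_ring \<mm> R"
    and "noetherian_ring R"
    and "krull_dim R = 1"
    and "regular_ideal I R"
    and "I \<noteq> carrier R"
    and "a \<in> carrier R"
    and "b \<in> carrier R"
  shows "(let R' = frac_embed R ` carrier R; \<mm>' = frac_embed R ` \<mm>; I' = frac_embed R ` I in
      cm_type (rees_quotient R I a b) =
        frac_length R (colon R I' I' \<inter> colon R R' \<mm>') R' + frac_length R (colon R I' \<mm>') I')
    \<and> (\<forall>a'\<in>carrier R. \<forall>b'\<in>carrier R.
          cm_type (rees_quotient R I a' b') = cm_type (rees_quotient R I a b))"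
  unfolding Let_def
  using cm_type_rees_quotient[OF assms(1,2,4,5)] assms(6,7) by metis

end
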